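(* Let $\rho\in(\tfrac12,1)$ and $\beta>2$. For every $(x,y)\in\mathbb R^2$ the limit metric $\psi_\rho$ is given by $$\psi_\rho(x,y)=L_\rho\big(\max\{|x|,|y|\},\min\{|x|,|y|\}\big).$$
   Context: Let $\rho\in(\tfrac12,1)$, $\beta>2$. Let $a_\rho:\mathbb R^2\to\{1,\beta\}$ be the $\mathbb Z^2$-periodic function with $a_\rho(x,y)=\beta$ if $(x,y)\in\left(\tfrac{1-\rho}{2},\tfrac{1+\rho}{2}\right)^2$ and $a_\rho(x,y)=1$ for all other $(x,y)\in[0,1]^2$. $\|\cdot\|$ is the Euclidean norm on $\mathbb R^2$. The functionals $\gamma\mapsto\int_0^1 a_\rho(\gamma(\tau)/\varepsilon)\|\gamma'(\tau)\|\,d\tau$ on $W^{1,1}((0,1);\mathbb R^2)$ $\Gamma(L^1)$-converge as $\varepsilon\to0$ to $\int_0^1\psi_\rho(\gamma'(\tau))\,d\tau$ (known result). The limit metric $\psi_\rho$ is convex, satisfies $\|\xi\|\le\psi_\rho(\xi)\le\beta\|\xi\|$, and is characterised by $$\psi_\rho(\xi)=\lim_{\varepsilon\to0}\inf\left\{\int_0^1a_\rho\!\left(\frac{\gamma(\tau)}{\varepsilon}\right)\|\gamma'(\tau)\|\,d\tau:\gamma\in W^{1,1}((0,1);\mathbb R^2),\ \gamma(0)=0,\ \gamma(1)=\xi\right\}$$ (the limit exists and is independent of the sequence $\varepsilon\to0$). Put $\ell_\rho(x):=\sqrt{(1-\rho)^2+(x-(1-\rho))^2}$. For real $x\ge y>0$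 define $$L_\rho(x,y):=y\,\ell_\rho(1)+\left(x-\lfloor x/y\rfloor y\right)\ell_\rho\left(\lfloor x/y\rfloor+1\right)+\left(y-x+\lfloor x/y\rfloor y\right)\ell_\rho\left(\lfloor x/y\rfloor\right),$$ and extend it to $y=0$, $x\ge0$ by continuity: $L_\rho(x,0):=\lim_{y\to0^+}L_\rho(x,y)=x$ for $x>0$, and $L_\rho(0,0):=0$. *)

theory Defs
  imports "HOL-Analysis.Analysis"
begin

(* The plane is real * real; the norm of this type is the Euclidean norm. *)

definition a_coeff :: "real \<Rightarrow> real \<Rightarrow> real \<times> real \<Rightarrow> real" where
  "a_coeff \<rho> \<beta> p =
     (if frac (fst p) \<in> {(1 - \<rho>) / 2 <..< (1 + \<rho>) / 2} \<and>
         frac (snd p) \<in> {(1 - \<rho>) / 2 <..< (1 + \<rho>) / 2}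
      then \<beta> else 1)"

(* C_c^infinity((0,1)).  The support is bounded and closed, so its being contained in (0,1)
   already makes it a compact subset of (0,1). *)
definition test_functions :: "(real \<Rightarrow> real) set" where
  "test_functions =
     {\<phi>. (\<forall>n t. ((deriv ^^ n) \<phi>) differentiable (at t)) \<and>
         closure {t. \<phi> t \<noteq> 0} \<subseteq> {0<..<1}}"

(* g is an L^1 weak derivative of f on (0,1); it is determined by f up to null sets. *)
definition weak_derivative ::
  "(real \<Rightarrow> 'a::euclidean_space) \<Rightarrow> (real \<Rightarrow> 'a) \<Rightarrow> bool" where
  "weak_derivative f g \<longleftrightarrow>
     set_integrable lebesgue {0<..<1} g \<and>
     (\<forall>\<phi>\<in>test_functions.
        (LINT t:{0<..<1}|lebesgue. deriv \<phi> t *\<^sub>R f t) =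
        - (LINT t:{0<..<1}|lebesgue. \<phi> t *\<^sub>R g t))"

definition W11 :: "(real \<Rightarrow> 'a::euclidean_space) set" where
  "W11 = {f. set_integrable lebesgue {0<..<1} f \<and> (\<exists>g. weak_derivative f g)}"

(* Every class in W^{1,1}((0,1)) has exactly one representative on (0,1) that extends
   continuously to [0,1]; the boundary values are the values of that representative,
   hence the continuity requirement. *)
definition W11_joining ::
  "'a::euclidean_space \<Rightarrow> 'a \<Rightarrow> (real \<Rightarrow> 'a) set" where
  "W11_joining p q = {\<gamma> \<in> W11. continuous_on {0..1} \<gamma> \<and> \<gamma> 0 = p \<and> \<gamma> 1 = q}"

(* The length of \<gamma>, with g in the role of \<gamma>'. *)
definition weighted_length ::
  "real \<Rightarrow> real \<Rightarrow> real \<Rightarrow> (real \<Rightarrow> real \<times> real) \<Rightarrow> (real \<Rightarrow> real \<times> real) \<Rightarrow> real" where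
  "weighted_length \<rho> \<beta> \<epsilon> \<gamma> g =
     (LINT t:{0<..<1}|lebesgue. a_coeff \<rho> \<beta> ((1 / \<epsilon>) *\<^sub>R \<gamma> t) * norm (g t))"

definition min_length :: "real \<Rightarrow> real \<Rightarrow> real \<Rightarrow> real \<times> real \<Rightarrow> real" where
  "min_length \<rho> \<beta> \<epsilon> \<xi> =
     Inf {weighted_length \<rho> \<beta> \<epsilon> \<gamma> g | \<gamma> g. \<gamma> \<in> W11_joining 0 \<xi> \<and> weak_derivative \<gamma> g}"

definition limit_metric :: "real \<Rightarrow> real \<Rightarrow> real \<times> real \<Rightarrow> real" where
  "limit_metric \<rho> \<beta> \<xi> = Lim (at_right 0) (\<lambda>\<epsilon>. min_length \<rho> \<beta> \<epsilon> \<xi>)"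

definition ell :: "real \<Rightarrow> real \<Rightarrow> real" where
  "ell \<rho> x = sqrt ((1 - \<rho>)\<^sup>2 + (x - (1 - \<rho>))\<^sup>2)"

(* Meant for x \<ge> y \<ge> 0.  The value at y = 0 is the limit of the formula as y tends to 0
   from the right if x > 0, and it is 0 if x = 0. *)
definition L_fun :: "real \<Rightarrow> real \<Rightarrow> real \<Rightarrow> real" where
  "L_fun \<rho> x y =
     (if y = 0 then x
      else y * ell \<rho> 1
         + (x - of_int \<lfloor>x / y\<rfloor> * y) * ell \<rho> (of_int \<lfloor>x / y\<rfloor> + 1)
         + (y - x + of_int \<lfloor>x / y\<rfloor> * y) * ell \<rho> (of_int \<lfloor>x / y\<rfloor>))"

end

(* Lengths are measured in units of the period, so that obstacles of side \<rho> leave horizontal and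
   vertical corridors of width 1 - \<rho>. Since \<beta> > 2, walking around an obstacle is never longer than
   crossing it, and a curve may be replaced by a chain of segments inside corridors. Merging
   consecutive segments in the same corridor, such a chain alternates between horizontal and vertical
   steps, each leading to another crossing of corridors. On the cone n y \<le> x \<le> (n + 1) y the function
   L_\<rho> is linear, and a calibration bounds the length of an alternating chain from below by this linear
   function up to a constant: each step is compared with the unit vector along the corresponding
   optimal segment, which joins two obstacle corners. Here \<rho> > 1/2 enters, because then the diagonal
   direction (1, 1) separates the directions of optimal horizontal and vertical steps. Conversely,
   the polygons through obstacle corners that advance by (n, 1) and (n + 1, 1) have this length. Both
   bounds have an error of order \<epsilon> after rescaling. *)

theory Submission
  imports Defs
begin

subsection \<open>Smooth cutoff functions and weak derivatives\<close>

text \<open>A curve may enter and leave obstacles infinitely often, so no finite chain is read off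
  from it. Instead the infimum \<open>street_dist\<close> over all chains is compared with the
  weighted length accumulated so far, and this inequality is propagated in time from one free point
  of the curve to another. The linear function alone does not bound the single steps of a chain: a
  segment may begin and end anywhere in its crossings, and a horizontal step can be shorter than its
  share of the linear function. The deficit is carried by the potentials \<open>pot_v\<close> and
  \<open>pot_h\<close>, which depend on the position within the crossing. Their gradient is
  (\<open>diag\<close>, \<open>diag\<close>) on the branches for upward steps. The second branches,
  with reflected gradient, exist because a chain may also turn back vertically. The linear function
  itself stems from the secant of \<open>ell \<rho>\<close> between n and n + 1, since optimal
  chains combine horizontal steps over n or n + 1 crossings with vertical steps over one. Admissible
  curves have only weak derivatives. What the lower bound draws from them is that an increment is at
  most the integral of the norm of the derivative.\<close>

primrec times_differentiable :: "nat \<Rightarrow> (real \<Rightarrow> real) \<Rightarrow> bool" where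
  "times_differentiable 0 f = True"
| "times_differentiable (Suc n) f =
    (\<exists>f'. (\<forall>x. (f has_real_derivative f' x) (at x)) \<and> times_differentiable n f')"

lemma times_differentiable_SucI:
  "(\<And>x. (f has_real_derivative f' x) (at x)) \<Longrightarrow> times_differentiable n f' \<Longrightarrow>
    times_differentiable (Suc n) f"
  by auto

lemma times_differentiable_SucD: "times_differentiable (Suc n) f \<Longrightarrow> times_differentiable n f"
  by (induction n arbitrary: f) auto

lemma times_differentiable_add:
  "times_differentiable n f \<Longrightarrow> times_differentiable n g \<Longrightarrow> times_differentiable n (\<lambda>x. f x + g x)"
proof (induction n arbitrary: f g)
  case (Suc n)
  then obtain f' g' where "\<And>x. (f has_real_derivative f' x) (at x)" "times_differentiable n f'"
    "\<And>x. (g has_real_derivative g' x) (at x)" "times_differentiable n g'" by auto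
  then show ?case using Suc.IH by (auto intro!: exI[of _ "\<lambda>x. f' x + g' x"] DERIV_add)
qed simp

lemma times_differentiable_const: "times_differentiable n (\<lambda>x. c)"
  by (induction n arbitrary: c) (auto intro!: exI[of _ "\<lambda>x. 0"])

lemma times_differentiable_mult:
  "times_differentiable n f \<Longrightarrow> times_differentiable n g \<Longrightarrow> times_differentiable n (\<lambda>x. f x * g x)"
proof (induction n arbitrary: f g)
  case (Suc n)
  then obtain f' g' where "\<And>x. (f has_real_derivative f' x) (at x)" "times_differentiable n f'"
    "\<And>x. (g has_real_derivative g' x) (at x)" "times_differentiable n g'" by auto
  moreover from this have "times_differentiable n (\<lambda>x. f' x * g x + g' x * f x)"
    using Suc times_differentiable_SucD by (intro times_differentiable_add) blast+
  ultimately show ?case by (auto intro!: exI[of _ "\<lambda>x. f' x * g x + g' x * f x"] DERIV_mult)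
qed simp

lemma times_differentiable_affine:
  "times_differentiable n f \<Longrightarrow> times_differentiable n (\<lambda>x. f (a * x + b))"
proof (induction n arbitrary: f)
  case (Suc n)
  then obtain f' where f': "\<And>x. (f has_real_derivative f' x) (at x)" "times_differentiable n f'" by auto
  have "times_differentiable n (\<lambda>x. f' (a * x + b) * a)"
    using Suc.IH[OF f'(2)] times_differentiable_mult times_differentiable_const by blast
  moreover have "((\<lambda>x. f (a * x + b)) has_real_derivative f' (a * x + b) * a) (at x)" for x
    by (rule DERIV_chain2[OF f'(1)]) (auto intro!: derivative_eq_intros)
  ultimately show ?case by (intro times_differentiable_SucI)
qed simp

lemma times_differentiable_inverse:
  assumes "\<And>x. f x \<noteq> 0"
  shows "times_differentiable n f \<Longrightarrow> times_differentiable n (\<lambda>x. inverse (f x))"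
proof (induction n)
  case (Suc n)
  then obtain f' where f': "\<And>x. (f has_real_derivative f' x) (at x)" "times_differentiable n f'" by auto
  have inv: "times_differentiable n (\<lambda>x. inverse (f x))"
    using Suc times_differentiable_SucD by blast
  have "times_differentiable n (\<lambda>x. (- 1) * (f' x * (inverse (f x) * inverse (f x))))"
    by (intro times_differentiable_mult times_differentiable_const inv f')
  moreover have "((\<lambda>x. inverse (f x)) has_real_derivative (- 1) * (f' x * (inverse (f x) * inverse (f x)))) (at x)" for x
    by (rule derivative_eq_intros f' refl assms | simp add: assms)+
  ultimately show ?case by (intro times_differentiable_SucI)
qed simp

text \<open>\<open>times_differentiable\<close> asks for the derivative as a witness, so its closure
  rules are inductions that never compute an iterated \<open>deriv\<close>. Here it is turned into
  the condition in \<open>test_functions\<close>.\<close>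

lemma higher_deriv_differentiable:
  "times_differentiable (Suc n) f \<Longrightarrow> ((deriv ^^ n) f) differentiable (at x)"
proof (induction n arbitrary: f)
  case 0
  then show ?case by (auto simp: real_differentiable_def)
next
  case (Suc n)
  then obtain f' where f': "\<And>x. (f has_real_derivative f' x) (at x)" "times_differentiable (Suc n) f'"
    by auto
  have "deriv f = f'" using f'(1) DERIV_imp_deriv by blast
  then show ?case using Suc.IH[OF f'(2)] by (simp add: funpow_swap1)
qed

text \<open>Differentiation maps each member into the span of the family, so one induction over all
  \<open>k\<close> at once gives smoothness. The case \<open>k = 0\<close> is the usual function
  exp(-1/x).\<close>

definition flat :: "nat \<Rightarrow> real \<Rightarrow> real" where
  "flat k x = (if x \<le> 0 then 0 else inverse x ^ k * exp (- inverse x))"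

lemma flat_deriv_zero: "(flat k has_real_derivative 0) (at 0)"
  unfolding has_field_derivative_iff
proof (rule filterlim_split_at)
  have "eventually (\<lambda>y. (flat k y - flat k 0) / (y - 0) = 0) (at_left 0)"
    by (auto simp: eventually_at_filter flat_def)
  then show "((\<lambda>y. (flat k y - flat k 0) / (y - 0)) \<longlongrightarrow> 0) (at_left 0)"
    by (rule tendsto_eventually)
next
  have "((\<lambda>y. inverse y ^ Suc k / exp (inverse y)) \<longlongrightarrow> (0::real)) (at_right 0)"
    by (rule filterlim_compose[OF tendsto_power_div_exp_0 filterlim_inverse_at_top_right])
  moreover have "eventually (\<lambda>y. inverse y ^ Suc k / exp (inverse y) = (flat k y - flat k 0) / (y - 0)) (at_right 0)"
    by (auto simp: eventually_at_filter flat_def exp_minus divide_inverse)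
  ultimately show "((\<lambda>y. (flat k y - flat k 0) / (y - 0)) \<longlongrightarrow> 0) (at_right 0)"
    by (rule Lim_transform_eventually)
qed

lemma flat_deriv: "(flat k has_real_derivative - real k * flat (k + 1) x + flat (k + 2) x) (at x)"
proof -
  consider "x < 0" | "x = 0" | "x > 0" by linarith
  then show ?thesis
  proof cases
    case 1
    have "((\<lambda>x. 0) has_real_derivative 0) (at x)" by simp
    then have "(flat k has_real_derivative 0) (at x)"
      by (rule has_field_derivative_transform_within_open[of _ _ _ "{..<0}"]) (use 1 in \<open>auto simp: flat_def\<close>)
    then show ?thesis using 1 by (simp add: flat_def)
  next
    case 2
    then show ?thesis using flat_deriv_zero by (simp add: flat_def)
  next
    case 3
    have "((\<lambda>x. inverse x ^ k * exp (- inverse x)) has_real_derivative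
        real k * (inverse x ^ (k - 1) * - (inverse x * 1 * inverse x)) * exp (- inverse x)
        + exp (- inverse x) * (inverse x * 1 * inverse x) * inverse x ^ k) (at x)"
      using 3 by (auto intro!: derivative_eq_intros)
    moreover have "real k * (inverse x ^ (k - 1) * - (inverse x * 1 * inverse x)) * exp (- inverse x)
        + exp (- inverse x) * (inverse x * 1 * inverse x) * inverse x ^ k
        = - real k * flat (k + 1) x + flat (k + 2) x"
      using 3 by (cases k) (simp_all add: flat_def power_add power2_eq_square algebra_simps)
    ultimately have "((\<lambda>x. inverse x ^ k * exp (- inverse x)) has_real_derivative
        - real k * flat (k + 1) x + flat (k + 2) x) (at x)" by simp
    then show ?thesis
      by (rule has_field_derivative_transform_within_open[of _ _ _ "{0<..}"]) (use 3 in \<open>auto simp: flat_def\<close>)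
  qed
qed

lemma times_differentiable_flat: "times_differentiable n (flat k)"
proof (induction n arbitrary: k)
  case (Suc n)
  have "times_differentiable n (\<lambda>x. - real k * flat (k + 1) x + flat (k + 2) x)"
    by (intro times_differentiable_add times_differentiable_mult times_differentiable_const Suc)
  with flat_deriv show ?case by (intro times_differentiable_SucI)
qed simp

text \<open>The quotient f(x) / (f(x) + f(1 - x)) for f = \<open>flat 0\<close>. After clearing
  denominators its monotonicity reads f(x) f(1 - y) \<le> f(y) f(1 - x), which follows from that of
  f.\<close>

lemma ex_smooth_step:
  obtains \<theta> :: "real \<Rightarrow> real" where "\<And>n. times_differentiable n \<theta>" "mono \<theta>"
    "\<And>x. x \<le> 0 \<Longrightarrow> \<theta> x = 0" "\<And>x. 1 \<le> x \<Longrightarrow> \<theta> x = 1"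
proof -
  define f where "f = flat 0"
  define \<theta> where "\<theta> = (\<lambda>x. f x * inverse (f x + f ((- 1) * x + 1)))"
  have f_zero: "f x = 0" if "x \<le> 0" for x using that by (simp add: f_def flat_def)
  have f_pos: "f x > 0" if "x > 0" for x using that by (simp add: f_def flat_def)
  have f_nonneg: "f x \<ge> 0" for x by (simp add: f_def flat_def)
  have f_mono: "f x \<le> f y" if "x \<le> y" for x y
    using that by (auto simp: f_def flat_def)
  have den: "f x + f ((- 1) * x + 1) > 0" for x
    using f_pos[of x] f_pos[of "1 - x"] f_nonneg[of x] f_nonneg[of "1 - x"] by (cases "x > 0") (auto intro: add_pos_nonneg add_nonneg_pos)
  have "times_differentiable n f" for n
    unfolding f_def by (rule times_differentiable_flat)
  then have "times_differentiable n \<theta>" for n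
    unfolding \<theta>_def
    by (intro times_differentiable_mult times_differentiable_inverse times_differentiable_add
        times_differentiable_affine less_imp_neq[OF den, symmetric])
  moreover have "mono \<theta>"
  proof (rule monoI)
    fix x y :: real assume "x \<le> y"
    then have "f x * f (- 1 * y + 1) \<le> f y * f (- 1 * x + 1)"
      by (intro mult_mono f_mono f_nonneg) auto
    then show "\<theta> x \<le> \<theta> y"
      unfolding \<theta>_def divide_inverse[symmetric] pos_divide_le_eq[OF den]
        times_divide_eq_left pos_le_divide_eq[OF den] by (simp add: algebra_simps)
  qed
  moreover have "\<theta> x = 0" if "x \<le> 0" for x using that f_zero by (simp add: \<theta>_def)
  moreover have "\<theta> x = 1" if "1 \<le> x" for x
    using that f_zero[of "1 - x"] f_pos[of x] by (simp add: \<theta>_def)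
  ultimately show ?thesis by (rule that)
qed

text \<open>The derivative \<open>\<psi>\<close> is delivered together with \<open>\<Phi>\<close>:
  it is a nonnegative kernel of mass one on [r, r + \<eta>], so integrating against it approximates
  the value at r.\<close>

lemma ex_smooth_cutoff:
  fixes r \<eta> :: real
  assumes "0 < \<eta>"
  obtains \<Phi> \<psi> :: "real \<Rightarrow> real" where "\<And>n. times_differentiable n \<Phi>"
    "\<And>x. (\<Phi> has_real_derivative \<psi> x) (at x)" "continuous_on UNIV \<psi>" "\<And>x. 0 \<le> \<psi> x"
    "\<And>x. x \<le> r \<Longrightarrow> \<Phi> x = 0" "\<And>x. r + \<eta> \<le> x \<Longrightarrow> \<Phi> x = 1" "\<And>x. 0 \<le> \<Phi> x \<and> \<Phi> x \<le> 1"
    "\<And>x. x \<notin> {r..r + \<eta>} \<Longrightarrow> \<psi> x = 0"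
proof -
  obtain \<theta> :: "real \<Rightarrow> real" where \<theta>: "\<And>n. times_differentiable n \<theta>" "mono \<theta>"
    "\<And>x. x \<le> 0 \<Longrightarrow> \<theta> x = 0" "\<And>x. 1 \<le> x \<Longrightarrow> \<theta> x = 1"
    using ex_smooth_step by blast
  define \<Phi> where "\<Phi> = (\<lambda>x. \<theta> ((1 / \<eta>) * x + (- r / \<eta>)))"
  have arg: "(1 / \<eta>) * x + (- r / \<eta>) = (x - r) / \<eta>" for x by (simp add: diff_divide_distrib)
  have td: "times_differentiable n \<Phi>" for n
    unfolding \<Phi>_def by (rule times_differentiable_affine[OF \<theta>(1)])
  have "times_differentiable (Suc (Suc 0)) \<Phi>" by (rule td)
  then obtain \<psi> \<psi>' where \<psi>: "\<And>x. (\<Phi> has_real_derivative \<psi> x) (at x)" "\<And>x. (\<psi> has_real_derivative \<psi>' x) (at x)"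
    by auto
  have cont: "continuous_on UNIV \<psi>"
    using \<psi>(2) by (intro continuous_at_imp_continuous_on) (auto intro: DERIV_isCont)
  have low: "\<Phi> x = 0" if "x \<le> r" for x
    unfolding \<Phi>_def arg using that assms by (intro \<theta>(3)) (simp add: divide_le_0_iff)
  have high: "\<Phi> x = 1" if "r + \<eta> \<le> x" for x
    unfolding \<Phi>_def arg using that assms by (intro \<theta>(4)) simp
  have mono: "\<Phi> x \<le> \<Phi> y" if "x \<le> y" for x y
    unfolding \<Phi>_def arg using that assms by (intro monoD[OF \<theta>(2)] divide_right_mono) auto
  have nonneg: "0 \<le> \<psi> x" for x
    using mono \<psi>(1) by (intro mono_on_imp_deriv_nonneg[of UNIV \<Phi>]) (auto simp: mono_on_def)
  have bounds: "0 \<le> \<Phi> x \<and> \<Phi> x \<le> 1" for x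
    using mono[of "min x r" x] low[of "min x r"] mono[of x "max x (r + \<eta>)"] high[of "max x (r + \<eta>)"] by simp
  have zero: "\<psi> x = 0" if "x \<notin> {r..r + \<eta>}" for x
  proof (cases "x < r")
    case True
    have "((\<lambda>x. 0) has_real_derivative 0) (at x)" by simp
    then have "(\<Phi> has_real_derivative 0) (at x)"
      by (rule has_field_derivative_transform_within_open[of _ _ _ "{..<r}"]) (use True low in auto)
    with \<psi>(1) show ?thesis using DERIV_unique by blast
  next
    case False
    have "((\<lambda>x. 1) has_real_derivative 0) (at x)" by simp
    then have "(\<Phi> has_real_derivative 0) (at x)"
      by (rule has_field_derivative_transform_within_open[of _ _ _ "{r + \<eta><..}"]) (use False that high in auto)
    with \<psi>(1) show ?thesis using DERIV_unique by blast
  qed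
  show ?thesis by (rule that[OF td \<psi>(1) cont nonneg low high bounds zero])
qed

section \<open>Increments of a continuous function with a weak derivative\<close>

lemma mollify_bound:
  fixes f :: "real \<Rightarrow> 'a::euclidean_space" and \<Phi> \<psi> :: "real \<Rightarrow> real"
  assumes f: "continuous_on {0..1} f"
    and \<psi>: "\<And>x. (\<Phi> has_real_derivative \<psi> x) (at x)" "continuous_on UNIV \<psi>" "\<And>x. 0 \<le> \<psi> x"
    and ends: "\<Phi> 0 = 0" "\<Phi> 1 = 1"
    and close: "\<And>x. x \<in> {0..1} \<Longrightarrow> \<psi> x \<noteq> 0 \<Longrightarrow> norm (f x - f r) \<le> e"
  shows "norm (integral {0..1} (\<lambda>x. \<psi> x *\<^sub>R f x) - f r) \<le> e"
proof -
  have \<psi>01: "continuous_on {0..1} \<psi>" using \<psi>(2) by (rule continuous_on_subset) simp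
  have int: "(\<psi> has_integral 1) {0..1}"
    using fundamental_theorem_of_calculus[of 0 1 \<Phi> \<psi>] \<psi>(1) ends
    by (simp add: has_real_derivative_iff_has_vector_derivative[symmetric] has_field_derivative_at_within)
  have "integral {0..1} (\<lambda>x. \<psi> x *\<^sub>R f x) - f r = integral {0..1} (\<lambda>x. \<psi> x *\<^sub>R f x) - integral {0..1} (\<lambda>x. \<psi> x *\<^sub>R f r)"
    using has_integral_scaleR_left[OF int, of "f r"] by (simp add: integral_unique)
  also have "\<dots> = integral {0..1} (\<lambda>x. \<psi> x *\<^sub>R f x - \<psi> x *\<^sub>R f r)"
    by (rule integral_diff[symmetric]) (intro integrable_continuous_real continuous_intros f \<psi>01)+
  also have "norm \<dots> \<le> integral {0..1} (\<lambda>x. \<psi> x * e)"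
  proof (rule integral_norm_bound_integral)
    fix x :: real assume "x \<in> {0..1}"
    then show "norm (\<psi> x *\<^sub>R f x - \<psi> x *\<^sub>R f r) \<le> \<psi> x * e"
      using close[of x] \<psi>(3)[of x]
      by (cases "\<psi> x = 0") (auto simp: scaleR_diff_right[symmetric] intro: mult_left_mono)
  qed (intro integrable_continuous_real continuous_intros f \<psi>01)+
  also have "\<dots> = e" using integral_unique[OF has_integral_mult_left[OF int, of e]] by (simp only: mult_1)
  finally show ?thesis .
qed

lemma set_integrable_bounded_scaleR:
  fixes g :: "'b \<Rightarrow> 'a::euclidean_space" and c :: "'b \<Rightarrow> real"
  assumes g: "set_integrable M S g" and c: "set_borel_measurable M S c"
    and bound: "\<And>x. x \<in> S \<Longrightarrow> \<bar>c x\<bar> \<le> B"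
  shows "set_integrable M S (\<lambda>x. c x *\<^sub>R g x)"
  unfolding set_integrable_def
proof (rule Bochner_Integration.integrable_bound)
  show "integrable M (\<lambda>x. \<bar>B\<bar> * norm (indicator S x *\<^sub>R g x))"
    using g unfolding set_integrable_def by (intro integrable_mult_right integrable_norm)
  have "(\<lambda>x. (indicator S x *\<^sub>R c x) *\<^sub>R (indicator S x *\<^sub>R g x)) \<in> borel_measurable M"
    using c borel_measurable_integrable[OF g[unfolded set_integrable_def]]
    unfolding set_borel_measurable_def by (rule borel_measurable_scaleR)
  moreover have "(\<lambda>x. (indicator S x *\<^sub>R c x) *\<^sub>R (indicator S x *\<^sub>R g x)) = (\<lambda>x. indicator S x *\<^sub>R c x *\<^sub>R g x)"
    by (auto simp: indicator_def)
  ultimately show "(\<lambda>x. indicator S x *\<^sub>R c x *\<^sub>R g x) \<in> borel_measurable M" by simp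
  show "AE x in M. norm (indicator S x *\<^sub>R c x *\<^sub>R g x) \<le> norm (\<bar>B\<bar> * norm (indicator S x *\<^sub>R g x))"
  proof (rule AE_I2)
    fix x
    show "norm (indicator S x *\<^sub>R c x *\<^sub>R g x) \<le> norm (\<bar>B\<bar> * norm (indicator S x *\<^sub>R g x))"
      using bound[of x] by (cases "x \<in> S") (auto intro!: mult_right_mono)
  qed
qed

lemma set_borel_measurable_continuous:
  assumes "continuous_on {0..1::real} f"
  shows "set_borel_measurable lebesgue {0<..<1} (f :: real \<Rightarrow> 'a::euclidean_space)"
proof -
  have "set_borel_measurable borel {0..1} f"
    unfolding set_borel_measurable_def using assms by (intro borel_measurable_continuous_on_indicator) simp
  then have "set_borel_measurable borel {0<..<1} f"
    by (rule set_borel_measurable_subset) auto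
  then show ?thesis
    unfolding set_borel_measurable_def by (simp add: measurable_completion)
qed

lemma absolutely_integrable_Icc:
  fixes g :: "real \<Rightarrow> 'a::euclidean_space"
  assumes "set_integrable lebesgue {0<..<1} g"
  shows "g absolutely_integrable_on {0..1}" "(\<lambda>t. norm (g t)) integrable_on {0..1}"
    "(LINT t:{0<..<1}|lebesgue. g t) = integral {0..1} g"
proof -
  show "g absolutely_integrable_on {0..1}"
    using assms by (simp add: absolutely_integrable_on_Icc_iff_Ioo)
  then show "(\<lambda>t. norm (g t)) integrable_on {0..1}" by (simp add: absolutely_integrable_on_def)
  show "(LINT t:{0<..<1}|lebesgue. g t) = integral {0..1} g"
    using set_lebesgue_integral_eq_integral(2)[OF assms] by (simp add: integral_open_interval_real)
qed

text \<open>The test function is a smoothed indicator of [s, t], a cutoff at s minus a cutoff at t.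
  Its derivative averages f just after s and just after t, which causes the two errors e; the other
  side of the identity is bounded because the test function has absolute value at most 1 and support
  in [s, t + \<eta>].\<close>

lemma weak_derivative_increment_approx:
  fixes f g :: "real \<Rightarrow> 'a::euclidean_space"
  assumes weak: "weak_derivative f g" and f: "continuous_on {0..1} f"
    and st: "0 < s" "s \<le> t" "0 < \<eta>" "t + \<eta> < 1"
    and close: "\<And>x. x \<in> {s..s + \<eta>} \<Longrightarrow> norm (f x - f s) \<le> e" "\<And>x. x \<in> {t..t + \<eta>} \<Longrightarrow> norm (f x - f t) \<le> e"
  shows "norm (f t - f s) \<le> integral {s..t + \<eta>} (\<lambda>x. norm (g x)) + 2 * e"
proof -
  have g: "set_integrable lebesgue {0<..<1} g" using weak by (simp add: weak_derivative_def)
  obtain \<Phi> \<psi> where 1: "\<And>n. times_differentiable n \<Phi>"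
    "\<And>x. (\<Phi> has_real_derivative \<psi> x) (at x)" "continuous_on UNIV \<psi>" "\<And>x. 0 \<le> \<psi> x"
    "\<And>x. x \<le> s \<Longrightarrow> \<Phi> x = 0" "\<And>x. s + \<eta> \<le> x \<Longrightarrow> \<Phi> x = 1" "\<And>x. 0 \<le> \<Phi> x \<and> \<Phi> x \<le> 1"
    "\<And>x. x \<notin> {s..s + \<eta>} \<Longrightarrow> \<psi> x = 0"
    using ex_smooth_cutoff[OF st(3), of s] by blast
  obtain \<Phi>' \<psi>' where 2: "\<And>n. times_differentiable n \<Phi>'"
    "\<And>x. (\<Phi>' has_real_derivative \<psi>' x) (at x)" "continuous_on UNIV \<psi>'" "\<And>x. 0 \<le> \<psi>' x"
    "\<And>x. x \<le> t \<Longrightarrow> \<Phi>' x = 0" "\<And>x. t + \<eta> \<le> x \<Longrightarrow> \<Phi>' x = 1" "\<And>x. 0 \<le> \<Phi>' x \<and> \<Phi>' x \<le> 1"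
    "\<And>x. x \<notin> {t..t + \<eta>} \<Longrightarrow> \<psi>' x = 0"
    using ex_smooth_cutoff[OF st(3), of t] by blast
  define \<phi> where "\<phi> = (\<lambda>x. \<Phi> x + (- 1) * \<Phi>' x)"
  have td: "times_differentiable n \<phi>" for n
    unfolding \<phi>_def by (intro times_differentiable_add times_differentiable_mult times_differentiable_const 1 2)
  have outside: "\<phi> x = 0" if "x \<notin> {s..t + \<eta>}" for x
    using that 1(5,6)[of x] 2(5,6)[of x] st by (cases "x < s") (auto simp: \<phi>_def)
  have "closure {x. \<phi> x \<noteq> 0} \<subseteq> {s..t + \<eta>}"
    using outside by (intro closure_minimal) (blast, simp)
  also have "\<dots> \<subseteq> {0<..<1}" using st by auto
  finally have "\<phi> \<in> test_functions"
    using higher_deriv_differentiable[OF td] by (simp add: test_functions_def)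
  then have weak_eq: "(LINT x:{0<..<1}|lebesgue. deriv \<phi> x *\<^sub>R f x) = - (LINT x:{0<..<1}|lebesgue. \<phi> x *\<^sub>R g x)"
    using weak by (simp add: weak_derivative_def)
  have D: "(\<phi> has_real_derivative \<psi> x - \<psi>' x) (at x)" for x
    using 1(2) 2(2) by (auto simp: \<phi>_def intro!: derivative_eq_intros)
  then have deriv_\<phi>: "deriv \<phi> = (\<lambda>x. \<psi> x - \<psi>' x)"
    by (intro ext DERIV_imp_deriv)
  have cont: "continuous_on {0..1} \<psi>" "continuous_on {0..1} \<psi>'"
    using 1(3) 2(3) by (auto intro: continuous_on_subset)
  have "(\<lambda>x. (\<psi> x - \<psi>' x) *\<^sub>R f x) absolutely_integrable_on {0..1}"
    by (intro absolutely_integrable_continuous_real continuous_intros cont f)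
  then have "set_integrable lebesgue {0<..<1} (\<lambda>x. (\<psi> x - \<psi>' x) *\<^sub>R f x)"
    by (simp add: absolutely_integrable_on_Icc_iff_Ioo)
  from absolutely_integrable_Icc(3)[OF this]
  have lhs: "(LINT x:{0<..<1}|lebesgue. deriv \<phi> x *\<^sub>R f x)
      = integral {0..1} (\<lambda>x. \<psi> x *\<^sub>R f x) - integral {0..1} (\<lambda>x. \<psi>' x *\<^sub>R f x)"
    unfolding deriv_\<phi> scaleR_diff_left
    by (simp, subst integral_diff) (auto intro!: integrable_continuous_real continuous_intros cont f)
  have \<phi>_cont: "continuous_on {0..1} \<phi>"
    using D by (intro continuous_at_imp_continuous_on ballI DERIV_isCont)
  have \<phi>_bound: "\<bar>\<phi> x\<bar> \<le> 1" for x
    using 1(7)[of x] 2(7)[of x] by (auto simp: \<phi>_def abs_le_iff)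
  have "set_integrable lebesgue {0<..<1} (\<lambda>x. \<phi> x *\<^sub>R g x)"
    by (rule set_integrable_bounded_scaleR[OF g set_borel_measurable_continuous[OF \<phi>_cont], of 1])
      (use \<phi>_bound in auto)
  note \<phi>g = absolutely_integrable_Icc[OF this]
  have sub: "(\<lambda>x. norm (g x)) integrable_on {s..t + \<eta>}"
    by (rule integrable_on_subinterval[OF absolutely_integrable_Icc(2)[OF g]]) (use st in auto)
  have "norm (integral {0..1} (\<lambda>x. \<phi> x *\<^sub>R g x)) \<le> integral {0..1} (\<lambda>x. if x \<in> {s..t + \<eta>} then norm (g x) else 0)"
  proof (rule integral_norm_bound_integral)
    show "(\<lambda>x. \<phi> x *\<^sub>R g x) integrable_on {0..1}"
      using \<phi>g(1) by (simp add: absolutely_integrable_on_def)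
    show "(\<lambda>x. if x \<in> {s..t + \<eta>} then norm (g x) else 0) integrable_on {0..1}"
      using sub st unfolding integrable_on_def by (subst has_integral_restrict) auto
    show "norm (\<phi> x *\<^sub>R g x) \<le> (if x \<in> {s..t + \<eta>} then norm (g x) else 0)" for x
      using \<phi>_bound[of x] outside[of x] by (auto intro: mult_left_le_one_le)
  qed
  also have "\<dots> = integral {s..t + \<eta>} (\<lambda>x. norm (g x))"
    using integrable_integral[OF sub] st by (intro integral_unique) (subst has_integral_restrict, auto)
  finally have rhs: "norm (integral {0..1} (\<lambda>x. \<phi> x *\<^sub>R g x)) \<le> integral {s..t + \<eta>} (\<lambda>x. norm (g x))" .
  define u v where "u = integral {0..1} (\<lambda>x. \<psi> x *\<^sub>R f x)" and "v = integral {0..1} (\<lambda>x. \<psi>' x *\<^sub>R f x)"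
  have u: "norm (u - f s) \<le> e"
    unfolding u_def
  proof (rule mollify_bound[OF f 1(2,3,4)])
    show "\<Phi> 0 = 0" "\<Phi> 1 = 1" using 1(5,6) st by simp_all
    show "norm (f x - f s) \<le> e" if "\<psi> x \<noteq> 0" for x
      using 1(8)[of x] that close(1)[of x] by blast
  qed
  have v: "norm (v - f t) \<le> e"
    unfolding v_def
  proof (rule mollify_bound[OF f 2(2,3,4)])
    show "\<Phi>' 0 = 0" "\<Phi>' 1 = 1" using 2(5,6) st by simp_all
    show "norm (f x - f t) \<le> e" if "\<psi>' x \<noteq> 0" for x
      using 2(8)[of x] that close(2)[of x] by blast
  qed
  have "u - v = - integral {0..1} (\<lambda>x. \<phi> x *\<^sub>R g x)"
    using weak_eq unfolding lhs \<phi>g(3) u_def v_def .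
  then have "v - u = integral {0..1} (\<lambda>x. \<phi> x *\<^sub>R g x)" by (simp add: algebra_simps)
  with rhs have uv: "norm (v - u) \<le> integral {s..t + \<eta>} (\<lambda>x. norm (g x))" by simp
  have "norm (f t - f s) = norm ((v - u) + ((u - f s) - (v - f t)))" by simp
  also have "\<dots> \<le> norm (v - u) + norm ((u - f s) - (v - f t))" by (rule norm_triangle_ineq)
  also have "norm ((u - f s) - (v - f t)) \<le> norm (u - f s) + norm (v - f t)" by (rule norm_triangle_ineq4)
  finally show ?thesis using u v uv by simp
qed

text \<open>Test functions vanish near 0 and 1, so the estimate is obtained at interior times and
  extended to the endpoints by continuity of f and of the indefinite integral.\<close>

lemma weak_derivative_increment:
  fixes f g :: "real \<Rightarrow> 'a::euclidean_space"
  assumes weak: "weak_derivative f g" and f: "continuous_on {0..1} f"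
    and st: "0 \<le> s" "s \<le> t" "t \<le> 1"
  shows "norm (f t - f s) \<le> integral {0..t} (\<lambda>x. norm (g x)) - integral {0..s} (\<lambda>x. norm (g x))"
proof -
  define I where "I = (\<lambda>t. integral {0..t} (\<lambda>x. norm (g x)))"
  have g: "(\<lambda>x. norm (g x)) integrable_on {0..1}"
    using weak absolutely_integrable_Icc(2) by (auto simp: weak_derivative_def)
  have I: "continuous_on {0..1} I"
    unfolding I_def using g by (rule indefinite_integral_continuous_1)
  have I_diff: "integral {a..b} (\<lambda>x. norm (g x)) = I b - I a" if "0 \<le> a" "a \<le> b" "b \<le> 1" for a b
    using Henstock_Kurzweil_Integration.integral_combine[where a = 0 and c = a and b = b and f = "\<lambda>x. norm (g x)"] that integrable_on_subinterval[OF g, of 0 b]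
    by (simp add: I_def)
  have inner: "norm (f t - f s) \<le> I t - I s" if st: "0 < s" "s \<le> t" "t < 1" for s t
  proof (rule field_le_epsilon)
    fix e :: real assume "0 < e"
    then have e: "0 < e / 3" by simp
    have mem: "s \<in> {0..1}" "t \<in> {0..1}" using st by auto
    obtain d1 where d1: "0 < d1" "\<And>x. x \<in> {0..1} \<Longrightarrow> dist x s < d1 \<Longrightarrow> dist (f x) (f s) < e / 3"
      using f mem(1) e unfolding continuous_on_iff by blast
    obtain d2 where d2: "0 < d2" "\<And>x. x \<in> {0..1} \<Longrightarrow> dist x t < d2 \<Longrightarrow> dist (f x) (f t) < e / 3"
      using f mem(2) e unfolding continuous_on_iff by blast
    obtain d3 where d3: "0 < d3" "\<And>x. x \<in> {0..1} \<Longrightarrow> dist x t < d3 \<Longrightarrow> dist (I x) (I t) < e / 3"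
      using I mem(2) e unfolding continuous_on_iff by blast
    define \<eta> where "\<eta> = min (min d1 d2) (min d3 (1 - t)) / 2"
    have \<eta>: "0 < \<eta>" "\<eta> < d1" "\<eta> < d2" "\<eta> < d3" "t + \<eta> < 1"
      using d1(1) d2(1) d3(1) st by (auto simp: \<eta>_def min_def field_simps)
    have "norm (f t - f s) \<le> integral {s..t + \<eta>} (\<lambda>x. norm (g x)) + 2 * (e / 3)"
    proof (rule weak_derivative_increment_approx[OF weak f st(1,2) \<eta>(1,5)])
      show "norm (f x - f s) \<le> e / 3" if "x \<in> {s..s + \<eta>}" for x
        using d1(2)[of x] that \<eta> st by (auto simp: dist_norm)
      show "norm (f x - f t) \<le> e / 3" if "x \<in> {t..t + \<eta>}" for x
        using d2(2)[of x] that \<eta> st by (auto simp: dist_norm)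
    qed
    also have "integral {s..t + \<eta>} (\<lambda>x. norm (g x)) = I (t + \<eta>) - I s"
      using st \<eta> by (intro I_diff) auto
    finally show "norm (f t - f s) \<le> I t - I s + e"
      using d3(2)[of "t + \<eta>"] st \<eta> by (simp add: dist_real_def abs_if split: if_splits)
  qed
  \<comment> \<open>\<open>h x n\<close> moves x towards 1 / 2 by a fraction \<open>c n\<close>: it
    is interior even for x = 0 and x = 1, keeps the order of s and t, and tends to x.\<close>
  define c where "c = (\<lambda>n. 1 / real (n + 2))"
  define h where "h = (\<lambda>x n. (1 - c n) * x + c n * (1 / 2))"
  have c: "0 < c n" "c n < 1" for n by (simp_all add: c_def)
  have c0: "c \<longlonglongrightarrow> 0" unfolding c_def using LIMSEQ_ignore_initial_segment[OF lim_const_over_n[of 1], of 2] by simp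
  have h_lim: "h x \<longlonglongrightarrow> x" for x
  proof -
    have "(\<lambda>n. (1 - c n) * x + c n * (1 / 2)) \<longlonglongrightarrow> (1 - 0) * x + 0 * (1 / 2)"
      by (intro tendsto_intros c0)
    then show ?thesis by (simp add: h_def)
  qed
  have h_in: "0 < h x n" "h x n < 1" if "0 \<le> x" "x \<le> 1" for x n
  proof -
    have "0 \<le> (1 - c n) * x" "(1 - c n) * x \<le> (1 - c n) * 1"
      using that c[of n] by (auto intro!: mult_left_mono)
    then show "0 < h x n" "h x n < 1" using c[of n] unfolding h_def mult_1_right by linarith+
  qed
  have lim: "(\<lambda>n. F (h x n)) \<longlonglongrightarrow> F x" if "continuous_on {0..1} F" "0 \<le> x" "x \<le> 1"
    for F :: "real \<Rightarrow> 'b::metric_space" and x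
  proof (rule continuous_on_tendsto_compose[OF that(1) h_lim])
    show "x \<in> {0..1}" using that by simp
    have "h x n \<in> {0..1}" for n using h_in[of x n] that by simp
    then show "\<forall>\<^sub>F n in sequentially. h x n \<in> {0..1}" by simp
  qed
  have "norm (f t - f s) \<le> I t - I s"
  proof (rule LIMSEQ_le)
    show "(\<lambda>n. norm (f (h t n) - f (h s n))) \<longlonglongrightarrow> norm (f t - f s)"
      using st by (intro tendsto_intros lim f) auto
    show "(\<lambda>n. I (h t n) - I (h s n)) \<longlonglongrightarrow> I t - I s"
      using st by (intro tendsto_intros lim I) auto
    have "h s n \<le> h t n" for n
      using st(2) c[of n] unfolding h_def by (intro add_right_mono mult_left_mono) auto
    then show "\<exists>N. \<forall>n\<ge>N. norm (f (h t n) - f (h s n)) \<le> I (h t n) - I (h s n)"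
      using st by (intro exI[of _ 0] allI impI inner h_in) auto
  qed
  then show ?thesis by (simp add: I_def)
qed

subsection \<open>Chains of segments in corridors\<close>

lemma norm_real_Pair_commute: "norm (x::real, y::real) = norm (y, x)"
  by (simp add: norm_Pair add.commute)

lemma ell_eq_norm: "ell \<rho> x = norm (1 - \<rho>, x - (1 - \<rho>))"
  by (simp add: ell_def norm_Pair)

text \<open>\<open>ell \<rho>\<close> is the norm along an affine line, so convexity is the triangle
  inequality. The weights are not normalised, to allow integer weights later.\<close>

lemma ell_convex:
  assumes "p \<ge> 0" "r \<ge> 0" "p * x + r * y = (p + r) * m"
  shows "(p + r) * ell \<rho> m \<le> p * ell \<rho> x + r * ell \<rho> y"
proof -
  let ?v = "\<lambda>x. (1 - \<rho>, x - (1 - \<rho>))"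
  have "(p + r) *\<^sub>R ?v m = p *\<^sub>R ?v x + r *\<^sub>R ?v y"
    using assms(3) by (simp add: algebra_simps)
  then have "norm ((p + r) *\<^sub>R ?v m) \<le> norm (p *\<^sub>R ?v x) + norm (r *\<^sub>R ?v y)"
    by (metis norm_triangle_ineq)
  with assms(1,2) show ?thesis
    by (simp only: ell_eq_norm norm_scaleR abs_of_nonneg add_nonneg_nonneg)
qed

lemma ell_diff_le: "ell \<rho> x - ell \<rho> y \<le> \<bar>x - y\<bar>"
proof -
  have "norm (1 - \<rho>, x - (1 - \<rho>)) - norm (1 - \<rho>, y - (1 - \<rho>))
      \<le> norm ((1 - \<rho>, x - (1 - \<rho>)) - (1 - \<rho>, y - (1 - \<rho>)))"
    by (rule norm_triangle_ineq2)
  then show ?thesis by (simp add: ell_eq_norm norm_Pair)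
qed

text \<open>Each coordinate of the unit vector in the direction (1, 1).\<close>

definition diag :: real where "diag = sqrt 2 / 2"

lemma diag_bounds: "0 < diag" "diag < 1"
proof -
  have "sqrt 2 < sqrt 4" by (subst real_sqrt_less_iff) simp
  then show "diag < 1" by (simp add: diag_def)
qed (simp add: diag_def)

lemma diag_square: "diag\<^sup>2 = 1 / 2"
  by (simp add: diag_def power_divide)

lemma scale_le_abs:
  fixes a t :: real
  assumes "0 \<le> a" "a \<le> 1"
  shows "a * t \<le> \<bar>t\<bar>"
proof -
  have "a * t \<le> a * \<bar>t\<bar>" using assms by (intro mult_left_mono) auto
  also have "\<dots> \<le> 1 * \<bar>t\<bar>" using assms by (intro mult_right_mono) auto
  finally show ?thesis by simp
qed

text \<open>A horizontal corridor is a strip of width \<open>1 - \<rho>\<close> about a line \<open>y = j\<close> with \<open>j\<close>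
  an integer, a vertical one is such a strip about a line \<open>x = i\<close>.\<close>

locale street_grid =
  fixes \<rho> :: real
  assumes rho_gt: "1 / 2 < \<rho>" and rho_lt: "\<rho> < 1"
begin

definition near :: "real \<Rightarrow> int \<Rightarrow> bool" where
  "near t j \<longleftrightarrow> \<bar>t - of_int j\<bar> \<le> (1 - \<rho>) / 2"

definition crossing :: "int \<Rightarrow> int \<Rightarrow> real \<times> real \<Rightarrow> bool" where
  "crossing i j z \<longleftrightarrow> near (fst z) i \<and> near (snd z) j"

text \<open>Corridors are convex, so the segment between two such points stays in the corridor and
  costs its Euclidean length.\<close>

definition share :: "real \<times> real \<Rightarrow> real \<times> real \<Rightarrow> bool" where
  "share z z' \<longleftrightarrow> (\<exists>j. near (snd z) j \<and> near (snd z') j) \<or> (\<exists>i. near (fst z) i \<and> near (fst z') i)"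

lemma near_unique:
  assumes "near t i" "near t j"
  shows "i = j"
proof -
  have "\<bar>real_of_int i - of_int j\<bar> < 1"
    using assms rho_gt unfolding near_def abs_le_iff abs_less_iff by (simp add: field_simps)
  then show ?thesis by linarith
qed

section \<open>Segment lengths \<open>ell\<close> and the diagonal direction\<close>

lemma ell_ge: "x - (1 - \<rho>) \<le> ell \<rho> x"
  unfolding ell_def by (rule order_trans[OF _ real_sqrt_sum_squares_ge2]) simp

lemma ell_pos: "0 < ell \<rho> x"
  unfolding ell_def using rho_lt by (simp add: add_pos_nonneg)

lemma ell_square: "(ell \<rho> x)\<^sup>2 = (1 - \<rho>)\<^sup>2 + (x - (1 - \<rho>))\<^sup>2"
  unfolding ell_def by (simp add: sum_nonneg)

text \<open>The vector (x - (1 - \<rho>), 1 - \<rho>) has length \<open>ell \<rho> x\<close> and its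
  first coordinate is the larger one. After normalisation one coordinate is therefore at least
  \<open>diag\<close> and the other at most \<open>diag\<close>.\<close>

lemma diag_ell:
  assumes "1 \<le> x"
  shows "1 - \<rho> \<le> diag * ell \<rho> x" "diag * ell \<rho> x \<le> x - (1 - \<rho>)"
proof -
  have le: "1 - \<rho> \<le> x - (1 - \<rho>)" using rho_gt assms by simp
  have sq: "(diag * ell \<rho> x)\<^sup>2 = ((1 - \<rho>)\<^sup>2 + (x - (1 - \<rho>))\<^sup>2) / 2"
    by (simp add: power_mult_distrib diag_square ell_square)
  have le2: "(1 - \<rho>)\<^sup>2 \<le> (x - (1 - \<rho>))\<^sup>2"
    using le rho_lt by (intro power_mono) auto
  have 1: "(1 - \<rho>)\<^sup>2 \<le> (diag * ell \<rho> x)\<^sup>2" "(diag * ell \<rho> x)\<^sup>2 \<le> (x - (1 - \<rho>))\<^sup>2"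
    unfolding sq using le2 by simp_all
  show "1 - \<rho> \<le> diag * ell \<rho> x"
    using 1(1) by (rule power2_le_imp_le) (use ell_pos[of x] diag_bounds in simp)
  show "diag * ell \<rho> x \<le> x - (1 - \<rho>)"
    using 1(2) by (rule power2_le_imp_le) (use le rho_lt in simp)
qed

text \<open>Cauchy--Schwarz with the unit vector along the shortest segment from the corner
  \<open>((1 - \<rho>) / 2, - (1 - \<rho>) / 2)\<close> of a crossing to the opposite corner of the crossing \<open>x\<close> steps away.\<close>

lemma norm_ge_ell:
  assumes "1 \<le> x" "\<bar>a\<bar> \<le> 1 - \<rho>" "\<bar>b\<bar> \<le> 1 - \<rho>"
  shows "ell \<rho> x + diag * (a + b) \<le> norm (x + a, b)"
proof -
  let ?l = "ell \<rho> x"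
  have "?l * (?l + diag * (a + b)) = ?l\<^sup>2 + (diag * ?l) * (a + (1 - \<rho>)) - (diag * ?l) * ((1 - \<rho>) - b)"
    by (simp add: algebra_simps power2_eq_square)
  \<comment> \<open>Both \<open>a + (1 - \<rho>)\<close> and \<open>(1 - \<rho>) - b\<close> are
    nonnegative, so by \<open>diag_ell\<close> the factor \<open>diag * ?l\<close> may be raised in
    the first product and lowered in the second.\<close>
  also have "\<dots> \<le> ?l\<^sup>2 + (x - (1 - \<rho>)) * (a + (1 - \<rho>)) - (1 - \<rho>) * ((1 - \<rho>) - b)"
    using diag_ell[OF assms(1)] assms(2,3)
    by (intro diff_mono add_mono mult_right_mono) auto
  also have "\<dots> = inner (x - (1 - \<rho>), 1 - \<rho>) (x + a, b)"
    unfolding ell_square by (simp add: inner_Pair algebra_simps power2_eq_square)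
  also have "\<dots> \<le> norm (x - (1 - \<rho>), 1 - \<rho>) * norm (x + a, b)"
    by (rule norm_cauchy_schwarz)
  also have "\<dots> = ?l * norm (x + a, b)"
    by (simp add: ell_eq_norm norm_real_Pair_commute)
  finally show ?thesis using ell_pos[of x] by simp
qed

text \<open>Keeps only the horizontal extent of the segment. This is the estimate for a horizontal
  step between two vertical steps in opposite directions, where the segment can be level instead of
  passing from one side of the corridor to the other.\<close>

lemma norm_ge_flat:
  assumes "\<bar>a\<bar> \<le> 1 - \<rho>"
  shows "x - (1 - \<rho>) + diag * (a + (1 - \<rho>)) \<le> norm (x + a, b :: real)"
proof -
  have "diag * (a + (1 - \<rho>)) \<le> 1 * (a + (1 - \<rho>))"
    using diag_bounds assms by (intro mult_right_mono) auto
  moreover have "x + a \<le> norm (x + a, b)"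
    using norm_fst_le[of "x + a" b] by simp
  ultimately show ?thesis by simp
qed

text \<open>With d = 1 - \<rho> and u = 1 / x, the square of \<open>ell \<rho> x / x\<close> is 1 -
  2 d u + 2 d d u u, which decreases in u on u \<le> 1 because d < 1 / 2. Long steps are thus dearer
  per crossing, and vertical steps over one crossing are best.\<close>

lemma ell_ratio_mono:
  assumes "1 \<le> x" "x \<le> y"
  shows "y * ell \<rho> x \<le> x * ell \<rho> y"
proof -
  define d where "d = 1 - \<rho>"
  have d: "0 < d" "d < 1 / 2" using rho_gt rho_lt by (auto simp: d_def)
  have "d * (x + y) \<le> (1 / 2) * (x + y)"
    using d assms by (intro mult_right_mono) auto
  also have "\<dots> \<le> x * y"
  proof -
    have "x \<le> x * y" "y \<le> x * y" using assms by (auto simp: mult_le_cancel_left1 mult_le_cancel_right1)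
    then show ?thesis by simp
  qed
  finally have "0 \<le> 2 * d * (y - x) * (x * y - d * (x + y))"
    using assms d by simp
  also have "\<dots> = x\<^sup>2 * (d\<^sup>2 + (y - d)\<^sup>2) - y\<^sup>2 * (d\<^sup>2 + (x - d)\<^sup>2)"
    by (simp add: algebra_simps power2_eq_square)
  finally have "(y * ell \<rho> x)\<^sup>2 \<le> (x * ell \<rho> y)\<^sup>2"
    by (simp add: power_mult_distrib ell_square d_def)
  then show ?thesis
    by (rule power2_le_imp_le) (use assms ell_pos[of y] in simp)
qed

lemma ell_one_le: "ell \<rho> 1 \<le> 1"
proof -
  have "(ell \<rho> 1)\<^sup>2 = 1 - 2 * (1 - \<rho>) * \<rho>"
    unfolding ell_square by (simp add: algebra_simps power2_eq_square)
  also have "\<dots> \<le> 1\<^sup>2" using rho_gt rho_lt by simp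
  finally show ?thesis by (rule power2_le_imp_le) simp
qed

text \<open>Cauchy--Schwarz for the vectors whose norms are \<open>ell \<rho> x\<close> and
  \<open>ell \<rho> (x + 1)\<close>. It makes the slope of the calibration large enough to pay for
  horizontal steps backwards.\<close>

lemma ell_increment_ge:
  assumes "1 \<le> x"
  shows "ell \<rho> x + diag \<le> ell \<rho> (x + 1)"
proof -
  have "ell \<rho> x * (ell \<rho> x + diag) = (ell \<rho> x)\<^sup>2 + diag * ell \<rho> x"
    by (simp add: algebra_simps power2_eq_square)
  also have "\<dots> \<le> (ell \<rho> x)\<^sup>2 + (x - (1 - \<rho>))" using diag_ell[OF assms] by simp
  also have "\<dots> = inner (1 - \<rho>, x - (1 - \<rho>)) (1 - \<rho>, x + 1 - (1 - \<rho>))"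
    unfolding ell_square by (simp add: inner_Pair algebra_simps power2_eq_square)
  also have "\<dots> \<le> norm (1 - \<rho>, x - (1 - \<rho>)) * norm (1 - \<rho>, x + 1 - (1 - \<rho>))"
    by (rule norm_cauchy_schwarz)
  also have "\<dots> = ell \<rho> x * ell \<rho> (x + 1)" by (simp add: ell_eq_norm)
  finally show ?thesis using ell_pos[of x] by simp
qed

text \<open>The Boolean tells whether the last step was horizontal; in a start it is arbitrary. Steps within one
  crossing are excluded because no potential on the crossings handles them;
  \<open>normal_chain_extend\<close> shows that nothing is lost.\<close>

inductive normal_chain :: "bool \<Rightarrow> int \<Rightarrow> int \<Rightarrow> real \<times> real \<Rightarrow> real \<Rightarrow> bool" where
  start: "crossing 0 0 z \<Longrightarrow> norm z \<le> c \<Longrightarrow> normal_chain h 0 0 z c"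
| horizontal: "normal_chain False i j w c \<Longrightarrow> i' \<noteq> i \<Longrightarrow> crossing i' j z \<Longrightarrow>
    normal_chain True i' j z (c + dist w z)"
| vertical: "normal_chain True i j w c \<Longrightarrow> j' \<noteq> j \<Longrightarrow> crossing i j' z \<Longrightarrow>
    normal_chain False i j' z (c + dist w z)"

lemma normal_chain_crossing: "normal_chain h i j z c \<Longrightarrow> crossing i j z"
  by (induction rule: normal_chain.induct) auto

lemma normal_chain_nonneg: "normal_chain h i j z c \<Longrightarrow> 0 \<le> c"
  by (induction rule: normal_chain.induct) (auto intro: order_trans[OF norm_ge_zero])

text \<open>A new step in the corridor of the last one is merged with it by the triangle inequality.
  If the merged step would stay in the crossing where the last step began, that step disappears and
  the induction hypothesis extends the shorter chain; a chain without steps simply moves its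
  starting point.\<close>

lemma normal_chain_extend:
  assumes "normal_chain h i j z c" "crossing i' j' z'" "i' = i \<or> j' = j"
  shows "\<exists>h' c'. c' \<le> c + dist z z' \<and> normal_chain h' i' j' z' c'"
  using assms
proof (induction arbitrary: i' j' z' rule: normal_chain.induct)
  case (start z c h)
  have c: "c + dist z z' \<le> c + dist z z'" by simp
  consider "i' = 0" "j' = 0" | "i' \<noteq> 0" "j' = 0" | "i' = 0" "j' \<noteq> 0"
    using start.prems(2) by blast
  then show ?case
  proof cases
    case 1
    have "norm z' \<le> norm z + dist z z'"
      using norm_triangle_ineq2[of z' z] by (simp add: dist_norm norm_minus_commute)
    then show ?thesis
      using 1 start normal_chain.start[of z' "c + dist z z'"] by fastforce
  next
    case 2
    then show ?thesis
      using start normal_chain.horizontal[OF normal_chain.start[OF start.hyps] 2(1)] by blast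
  next
    case 3
    then show ?thesis
      using start normal_chain.vertical[OF normal_chain.start[OF start.hyps] 3(2)] by blast
  qed
next
  case (horizontal i j w c k z)
  have tri: "dist w z' \<le> dist w z + dist z z'" by (rule dist_triangle)
  consider "j' = j" "i' \<noteq> i" | "j' = j" "i' = i" | "j' \<noteq> j" "i' = k"
    using horizontal.prems(2) by blast
  then show ?case
  proof cases
    case 1
    have "normal_chain True i' j z' (c + dist w z')"
      using normal_chain.horizontal[OF horizontal.hyps(1) 1(2)] horizontal.prems(1) 1 by simp
    moreover have "c + dist w z' \<le> c + dist w z + dist z z'" using tri by simp
    ultimately show ?thesis using 1(1) by blast
  next
    case 2
    with horizontal.IH[OF horizontal.prems(1)] obtain h' c'
      where "c' \<le> c + dist w z'" "normal_chain h' i' j' z' c'" by blast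
    moreover from this(1) tri have "c' \<le> c + dist w z + dist z z'" by linarith
    ultimately show ?thesis by blast
  next
    case 3
    have "normal_chain True k j z (c + dist w z)"
      by (rule normal_chain.horizontal) (use horizontal in auto)
    from normal_chain.vertical[OF this 3(1)] 3 horizontal.prems(1) show ?thesis by blast
  qed
next
  case (vertical i j w c k z)
  have tri: "dist w z' \<le> dist w z + dist z z'" by (rule dist_triangle)
  consider "i' = i" "j' \<noteq> j" | "i' = i" "j' = j" | "i' \<noteq> i" "j' = k"
    using vertical.prems(2) by blast
  then show ?case
  proof cases
    case 1
    have "normal_chain False i j' z' (c + dist w z')"
      using normal_chain.vertical[OF vertical.hyps(1) 1(2)] vertical.prems(1) 1 by simp
    moreover have "c + dist w z' \<le> c + dist w z + dist z z'" using tri by simp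
    ultimately show ?thesis using 1(1) by blast
  next
    case 2
    with vertical.IH[OF vertical.prems(1)] obtain h' c'
      where "c' \<le> c + dist w z'" "normal_chain h' i' j' z' c'" by blast
    moreover from this(1) tri have "c' \<le> c + dist w z + dist z z'" by linarith
    ultimately show ?thesis by blast
  next
    case 3
    have "normal_chain False i k z (c + dist w z)"
      by (rule normal_chain.vertical) (use vertical in auto)
    from normal_chain.horizontal[OF this 3(1)] 3 vertical.prems(1) show ?thesis by blast
  qed
qed

text \<open>The last segment may stop between crossings, in either corridor through the last
  crossing. Only values at \<open>free\<close> points are meaningful: elsewhere the infimum is over
  the empty set.\<close>

definition street_dist :: "real \<times> real \<Rightarrow> real" where
  "street_dist z = Inf {c + dist w z | h i j w c. normal_chain h i j w c \<and> (near (fst z) i \<or> near (snd z) j)}"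

definition free :: "real \<times> real \<Rightarrow> bool" where
  "free z \<longleftrightarrow> (\<exists>i. near (fst z) i) \<or> (\<exists>j. near (snd z) j)"

lemma near_self: "near (of_int i) i"
  using rho_lt by (simp add: near_def)

lemma near_zero: "near 0 0"
  using near_self[of 0] by simp

lemma street_dist_le:
  assumes "normal_chain h i j w c" "near (fst z) i \<or> near (snd z) j"
  shows "street_dist z \<le> c + dist w z"
  unfolding street_dist_def
proof (rule cInf_lower)
  show "bdd_below {c + dist w z |h i j w c. normal_chain h i j w c \<and> (near (fst z) i \<or> near (snd z) j)}"
    by (rule bdd_belowI[of _ 0]) (auto dest!: normal_chain_nonneg)
qed (use assms in blast)

lemma street_dist_greatest:
  assumes "free z"
    and "\<And>h i j w c. normal_chain h i j w c \<Longrightarrow> near (fst z) i \<or> near (snd z) j \<Longrightarrow> b \<le> c + dist w z"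
  shows "b \<le> street_dist z"
  unfolding street_dist_def
proof (rule cInf_greatest)
  \<comment> \<open>Every corridor meets one of the two corridors through the origin in a crossing
    that is at most one step away, so the set of costs is nonempty.\<close>
  have 0: "normal_chain h 0 0 0 0" for h
    by (rule normal_chain.start) (use near_zero in \<open>auto simp: crossing_def\<close>)
  consider i where "near (fst z) i" | j where "near (snd z) j"
    using assms(1) unfolding free_def by blast
  then show "{c + dist w z |h i j w c. normal_chain h i j w c \<and> (near (fst z) i \<or> near (snd z) j)} \<noteq> {}"
  proof cases
    case 1
    obtain h c where "normal_chain h i 0 (of_int i, 0) c"
      using normal_chain_extend[OF 0, where i' = i and j' = 0 and z' = "(of_int i, 0)"] near_self near_zero
      by (auto simp: crossing_def)
    with 1 show ?thesis by blast
  next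
    case 2
    obtain h c where "normal_chain h 0 j (0, of_int j) c"
      using normal_chain_extend[OF 0, where i' = 0 and j' = j and z' = "(0, of_int j)"] near_self near_zero
      by (auto simp: crossing_def)
    with 2 show ?thesis by blast
  qed
qed (use assms(2) in blast)

lemma street_dist_zero: "street_dist 0 \<le> 0"
proof -
  have "normal_chain True 0 0 0 0"
    by (rule normal_chain.start) (use near_zero in \<open>auto simp: crossing_def\<close>)
  from street_dist_le[OF this, of 0] near_zero show ?thesis by simp
qed

lemma share_free: "share z z' \<Longrightarrow> free z \<and> free z'"
  unfolding share_def free_def by blast

lemma share_commute: "share z z' \<longleftrightarrow> share z' z"
  unfolding share_def by blast

text \<open>If \<open>z'\<close> lies in neither corridor of the last crossing, then
  \<open>z\<close> lies where one of these meets the corridor shared with \<open>z'\<close>. The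
  chain is then extended to \<open>z\<close> itself, from where \<open>z'\<close> is one segment
  away.\<close>

lemma street_dist_share:
  assumes "share z z'"
  shows "street_dist z' \<le> street_dist z + dist z z'"
proof -
  have "street_dist z' - dist z z' \<le> street_dist z"
  proof (rule street_dist_greatest)
    show "free z" using share_free[OF assms] by simp
    fix h i j w c
    assume chain: "normal_chain h i j w c" and ij: "near (fst z) i \<or> near (snd z) j"
    have tri: "dist w z' \<le> dist w z + dist z z'" by (rule dist_triangle)
    show "street_dist z' - dist z z' \<le> c + dist w z"
    proof (cases "near (fst z') i \<or> near (snd z') j")
      case True
      from street_dist_le[OF chain this] tri show ?thesis by simp
    next
      case False
      have "\<exists>k l. crossing k l z \<and> (k = i \<or> l = j) \<and> (near (fst z') k \<or> near (snd z') l)"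
        using assms ij False unfolding share_def crossing_def by (metis near_unique)
      then obtain k l where kl: "crossing k l z" "k = i \<or> l = j" "near (fst z') k \<or> near (snd z') l"
        by blast
      from normal_chain_extend[OF chain kl(1,2)] obtain h' c'
        where c': "c' \<le> c + dist w z" "normal_chain h' k l z c'" by blast
      from street_dist_le[OF c'(2) kl(3)] c'(1) show ?thesis by simp
    qed
  qed
  then show ?thesis by simp
qed

section \<open>Obstacles, and curves that pass through them\<close>

definition blocked :: "real \<Rightarrow> bool" where
  "blocked t \<longleftrightarrow> (1 - \<rho>) / 2 < frac t \<and> frac t < (1 + \<rho>) / 2"

lemma not_blocked_iff: "\<not> blocked t \<longleftrightarrow> (\<exists>i. near t i)"
proof
  assume "\<not> blocked t"
  then consider "frac t \<le> (1 - \<rho>) / 2" | "(1 + \<rho>) / 2 \<le> frac t"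
    unfolding blocked_def by linarith
  then show "\<exists>i. near t i"
  proof cases
    case 1
    then have "near t \<lfloor>t\<rfloor>" using frac_ge_0[of t] by (simp add: near_def frac_def)
    then show ?thesis ..
  next
    case 2
    then have "near t (\<lfloor>t\<rfloor> + 1)" using frac_lt_1[of t] by (simp add: near_def frac_def abs_le_iff field_simps)
    then show ?thesis ..
  qed
next
  assume "\<exists>i. near t i"
  then obtain i where "\<bar>t - of_int i\<bar> \<le> (1 - \<rho>) / 2" unfolding near_def ..
  then have i: "- (1 - \<rho>) / 2 \<le> t - of_int i" "t - of_int i \<le> (1 - \<rho>) / 2"
    unfolding abs_le_iff by linarith+
  show "\<not> blocked t"
  proof (cases "of_int i \<le> t")
    case True
    then have "\<lfloor>t\<rfloor> = i" using i rho_gt by (simp add: floor_eq_iff)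
    then show ?thesis using i by (simp add: blocked_def frac_def)
  next
    case False
    then have "\<lfloor>t\<rfloor> = i - 1" using i rho_gt by (simp add: floor_eq_iff)
    then show ?thesis using i by (simp add: blocked_def frac_def field_simps)
  qed
qed

lemma free_iff: "free z \<longleftrightarrow> \<not> (blocked (fst z) \<and> blocked (snd z))"
  unfolding free_def using not_blocked_iff by blast

lemma blocked_iff_between:
  "blocked t \<longleftrightarrow> (\<exists>k::int. of_int k + (1 - \<rho>) / 2 < t \<and> t < of_int k + (1 + \<rho>) / 2)"
proof
  assume "blocked t"
  then show "\<exists>k::int. of_int k + (1 - \<rho>) / 2 < t \<and> t < of_int k + (1 + \<rho>) / 2"
    by (intro exI[of _ "\<lfloor>t\<rfloor>"]) (simp add: blocked_def frac_def field_simps)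
next
  assume "\<exists>k::int. of_int k + (1 - \<rho>) / 2 < t \<and> t < of_int k + (1 + \<rho>) / 2"
  then obtain k :: int where k: "of_int k + (1 - \<rho>) / 2 < t" "t < of_int k + (1 + \<rho>) / 2" by blast
  then have "\<lfloor>t\<rfloor> = k" using rho_lt unfolding floor_eq_iff by (simp add: field_simps)
  with k show "blocked t" by (simp add: blocked_def frac_def field_simps)
qed

lemma open_blocked: "open {t. blocked t}"
proof -
  have "{t. blocked t} = (\<Union>k::int. {of_int k + (1 - \<rho>) / 2 <..< of_int k + (1 + \<rho>) / 2})"
    by (auto simp: blocked_iff_between)
  then show ?thesis by auto
qed

lemma near_locally_constant:
  "\<exists>r>0. \<forall>t'. \<bar>t' - t\<bar> < r \<longrightarrow> (\<forall>i. near t' i \<longrightarrow> near t i)"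
proof (cases "blocked t")
  case True
  then obtain r where "r > 0" "\<And>t'. dist t' t < r \<Longrightarrow> blocked t'"
    using open_blocked unfolding open_dist by blast
  then show ?thesis using not_blocked_iff by (metis dist_real_def)
next
  case False
  then obtain i where i: "near t i" using not_blocked_iff by blast
  \<comment> \<open>The radius \<rho> / 2 works: the centres i and k differ by less than (1 -
    \<rho>) + \<rho> / 2, hence by less than 1.\<close>
  have "near t k" if "\<bar>t' - t\<bar> < \<rho> / 2 \<and> near t' k" for t' k
  proof -
    have "\<bar>real_of_int i - of_int k\<bar> < 1"
      using i that rho_gt unfolding near_def abs_le_iff abs_less_iff by (simp add: field_simps)
    then have "i = k" by linarith
    with i show ?thesis by simp
  qed
  then show ?thesis using rho_gt by (intro exI[of _ "\<rho> / 2"]) auto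
qed

lemma share_locally:
  assumes "free z"
  shows "\<exists>r>0. \<forall>z'. free z' \<longrightarrow> dist z' z < r \<longrightarrow> share z z'"
proof -
  obtain r where r: "r > 0" "\<And>t' i. \<bar>t' - fst z\<bar> < r \<Longrightarrow> near t' i \<Longrightarrow> near (fst z) i"
    using near_locally_constant by blast
  obtain s where s: "s > 0" "\<And>t' i. \<bar>t' - snd z\<bar> < s \<Longrightarrow> near t' i \<Longrightarrow> near (snd z) i"
    using near_locally_constant by blast
  have "share z z'" if "free z'" "dist z' z < min r s" for z'
  proof -
    have "\<bar>fst z' - fst z\<bar> < r" "\<bar>snd z' - snd z\<bar> < s"
      using that(2) dist_fst_le[of z' z] dist_snd_le[of z' z] by (auto simp: dist_real_def)
    with r s that(1) show ?thesis unfolding share_def free_def by blast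
  qed
  then show ?thesis using r(1) s(1) by (intro exI[of _ "min r s"]) auto
qed

definition obstacle :: "int \<Rightarrow> int \<Rightarrow> (real \<times> real) set" where
  "obstacle k l = {of_int k + (1 - \<rho>) / 2 .. of_int k + (1 + \<rho>) / 2} \<times> {of_int l + (1 - \<rho>) / 2 .. of_int l + (1 + \<rho>) / 2}"

lemma near_side:
  assumes "near t i" "t \<in> {of_int k + (1 - \<rho>) / 2 .. of_int k + (1 + \<rho>) / 2}"
  shows "i = k \<and> t = of_int k + (1 - \<rho>) / 2 \<or> i = k + 1 \<and> t = of_int k + (1 + \<rho>) / 2"
proof -
  have "real_of_int k - of_int i \<le> 0" "real_of_int i - of_int k \<le> 1"
    using assms unfolding near_def abs_le_iff by (simp_all add: field_simps)
  then have "i = k \<or> i = k + 1" by linarith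
  then show ?thesis using assms unfolding near_def abs_le_iff by (auto simp: field_simps)
qed

lemma norm_ge_half_sum: "\<bar>x\<bar> + \<bar>y\<bar> \<le> 2 * norm (x :: real, y :: real)"
  using norm_fst_le[of x y] norm_snd_le[of y x] by simp

lemma street_dist_path:
  assumes "share a b" "share b c" "share c d"
  shows "street_dist d \<le> street_dist a + (dist a b + dist b c + dist c d)"
  using street_dist_share[OF assms(1)] street_dist_share[OF assms(2)] street_dist_share[OF assms(3)]
  by simp

text \<open>Adjacent sides are joined through one corner, opposite sides along the nearer third side.\<close>

lemma street_dist_obstacle:
  assumes "z \<in> obstacle k l" "z' \<in> obstacle k l" "free z" "free z'"
  shows "street_dist z' \<le> street_dist z + 2 * dist z z'"
proof -
  obtain x y where z: "z = (x, y)" by (cases z)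
  obtain x' y' where z': "z' = (x', y')" by (cases z')
  define a where "a = (\<lambda>m::int. of_int m + (1 - \<rho>) / 2)"
  define b where "b = (\<lambda>m::int. of_int m + (1 + \<rho>) / 2)"
  have box: "x \<in> {a k..b k}" "y \<in> {a l..b l}" "x' \<in> {a k..b k}" "y' \<in> {a l..b l}"
    using assms(1,2) by (auto simp: z z' obstacle_def a_def b_def)
  have nab: "near (a m) m" "near (b m) (m + 1)" for m
    using rho_lt by (auto simp: near_def a_def b_def field_simps)
  have width: "b m - a m = \<rho>" for m by (simp add: a_def b_def field_simps)
  have dist_eq: "dist (p, q) (p', q') = norm (p' - p, q' - q)" for p q p' q' :: real
    by (subst dist_commute) (simp add: dist_norm)
  have straight: "dist (p, q) (p, q') = \<bar>q' - q\<bar>" "dist (p, q) (p', q) = \<bar>p' - p\<bar>" for p q p' q' :: real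
    by (simp_all add: dist_eq norm_Pair)
  have sum_le: "\<bar>x' - x\<bar> + \<bar>y' - y\<bar> \<le> 2 * dist z z'"
    unfolding z z' dist_eq by (rule norm_ge_half_sum)
  have ends: "t = a m \<and> i = m \<or> t = b m \<and> i = m + 1" if "near t i" "t \<in> {a m..b m}" for t i m
    using near_side[OF that(1), of m] that(2) by (auto simp: a_def b_def)
  consider (vv) i i' where "near x i" "near x' i'" | (hh) j j' where "near y j" "near y' j'"
    | (vh) i j' where "near x i" "near y' j'" | (hv) j i' where "near y j" "near x' i'"
    using assms(3,4) unfolding free_def z z' by auto
  then show ?thesis
  proof cases
    case vv
    show ?thesis
    proof (cases "i = i'")
      case True
      then have "share z z'" using vv unfolding share_def z z' by auto
      from street_dist_share[OF this] show ?thesis using zero_le_dist[of z z'] by linarith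
    next
      case False
      have r: "\<bar>x' - x\<bar> = \<rho>"
        using ends[OF vv(1) box(1)] ends[OF vv(2) box(3)] False width[of k] rho_gt by auto
      have d: "\<rho> \<le> dist z z'"
        using norm_fst_le[of "x' - x" "y' - y"] r unfolding z z' dist_eq by simp
      have via: "street_dist z' \<le> street_dist z + (\<bar>e - y\<bar> + \<rho> + \<bar>y' - e\<bar>)" if "near e m" for e m
      proof -
        have "share z (x, e)" "share (x, e) (x', e)" "share (x', e) z'"
          using vv that unfolding share_def z z' by auto
        from street_dist_path[OF this] show ?thesis using r unfolding z z' straight by simp
      qed
      \<comment> \<open>Since y and y' lie between the two horizontal sides, the detours along these
        sides have total length 4 \<rho>. The shorter one is at most 2 \<rho>, and the opposite
        sides are \<rho> apart.\<close>
      show ?thesis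
        using via[OF nab(1)[of l]] via[OF nab(2)[of l]] d box(2,4) width[of l] by auto
    qed
  next
    case hh
    show ?thesis
    proof (cases "j = j'")
      case True
      then have "share z z'" using hh unfolding share_def z z' by auto
      from street_dist_share[OF this] show ?thesis using zero_le_dist[of z z'] by linarith
    next
      case False
      have r: "\<bar>y' - y\<bar> = \<rho>"
        using ends[OF hh(1) box(2)] ends[OF hh(2) box(4)] False width[of l] rho_gt by auto
      have d: "\<rho> \<le> dist z z'"
        using norm_snd_le[of "y' - y" "x' - x"] r unfolding z z' dist_eq by simp
      have via: "street_dist z' \<le> street_dist z + (\<bar>e - x\<bar> + \<rho> + \<bar>x' - e\<bar>)" if "near e m" for e m
      proof -
        have "share z (e, y)" "share (e, y) (e, y')" "share (e, y') z'"
          using hh that unfolding share_def z z' by auto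
        from street_dist_path[OF this] show ?thesis using r unfolding z z' straight by simp
      qed
      show ?thesis
        using via[OF nab(1)[of k]] via[OF nab(2)[of k]] d box(1,3) width[of k] by auto
    qed
  next
    case vh
    have "share z (x, y')" "share (x, y') (x, y')" "share (x, y') z'"
      using vh unfolding share_def z z' by auto
    from street_dist_path[OF this] sum_le show ?thesis unfolding z z' straight by simp
  next
    case hv
    have "share z (x', y)" "share (x', y) (x', y)" "share (x', y) z'"
      using hv unfolding share_def z z' by auto
    from street_dist_path[OF this] sum_le show ?thesis unfolding z z' straight by simp
  qed
qed

lemma closed_free: "closed {z. free z}"
proof -
  have "{z. free z} = - ({t. blocked t} \<times> {t. blocked t})"
    by (auto simp: free_iff)
  then show ?thesis using open_blocked by (simp add: closed_Compl open_Times)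
qed

lemma continuous_street_dist: "continuous_on {z. free z} street_dist"
  unfolding continuous_on_iff
proof (intro ballI allI impI)
  fix z and e :: real
  assume "z \<in> {z. free z}" "0 < e"
  then obtain r where r: "r > 0" "\<And>z'. free z' \<Longrightarrow> dist z' z < r \<Longrightarrow> share z z'"
    using share_locally by blast
  have "dist (street_dist z') (street_dist z) < e" if "free z'" "dist z' z < min r e" for z'
    using street_dist_share[of z z'] street_dist_share[of z' z] r(2)[of z'] that
    by (simp add: share_commute dist_commute dist_real_def abs_less_iff)
  then show "\<exists>d>0. \<forall>z'\<in>{z. free z}. dist z' z < d \<longrightarrow> dist (street_dist z') (street_dist z) < e"
    using r(1) \<open>0 < e\<close> by (intro exI[of _ "min r e"]) auto
qed

text \<open>Integers are not blocked, so by connectedness the values at inner times lie between two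
  consecutive integers. The endpoints follow by closure, which is why the resulting interval is
  closed.\<close>

lemma blocked_interval:
  fixes f :: "real \<Rightarrow> real"
  assumes "s < t" "continuous_on {s..t} f" "\<forall>u\<in>{s<..<t}. blocked (f u)"
  shows "\<exists>k::int. \<forall>u\<in>{s..t}. f u \<in> {of_int k + (1 - \<rho>) / 2 .. of_int k + (1 + \<rho>) / 2}"
proof -
  define m where "m = (s + t) / 2"
  define k where "k = \<lfloor>f m\<rfloor>"
  have m: "m \<in> {s<..<t}" using assms(1) by (simp add: m_def)
  have conn: "connected (f ` {s<..<t})"
    using assms(2) by (intro connected_continuous_image) (auto intro: continuous_on_subset)
  have no_int: "of_int i \<notin> f ` {s<..<t}" for i :: int
    using assms(3) near_self not_blocked_iff by (metis imageE)
  have "f u \<in> {of_int k + (1 - \<rho>) / 2 .. of_int k + (1 + \<rho>) / 2}" if u: "u \<in> {s<..<t}" for u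
  proof -
    have km: "of_int k \<le> f m" "f m < of_int k + 1" by (simp_all add: k_def)
    have "of_int k \<le> f u"
    proof (rule ccontr)
      assume "\<not> of_int k \<le> f u"
      then have "of_int k \<in> f ` {s<..<t}"
        using connectedD_interval[OF conn, of "f u" "f m" "of_int k"] u m km by auto
      with no_int show False by blast
    qed
    moreover have "f u < of_int (k + 1)"
    proof (rule ccontr)
      assume "\<not> f u < of_int (k + 1)"
      then have "of_int (k + 1) \<in> f ` {s<..<t}"
        using connectedD_interval[OF conn, of "f m" "f u" "of_int (k + 1)"] u m km by auto
      with no_int show False by blast
    qed
    ultimately have "\<lfloor>f u\<rfloor> = k" by (simp add: floor_eq_iff)
    moreover have "blocked (f u)" using assms(3) u by blast
    ultimately show ?thesis by (simp add: blocked_def frac_def field_simps)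
  qed
  then have "f ` closure {s<..<t} \<subseteq> {of_int k + (1 - \<rho>) / 2 .. of_int k + (1 + \<rho>) / 2}"
    using assms(1,2) by (intro image_closure_subset) auto
  moreover have "closure {s<..<t} = {s..t}" using assms(1) by simp
  ultimately show ?thesis by (metis image_subset_iff)
qed

lemma obstacle_interval:
  fixes z :: "real \<Rightarrow> real \<times> real"
  assumes "s < t" "continuous_on {s..t} z" "\<forall>u\<in>{s<..<t}. \<not> free (z u)"
  shows "\<exists>k l. z s \<in> obstacle k l \<and> z t \<in> obstacle k l"
proof -
  obtain k where "\<forall>u\<in>{s..t}. fst (z u) \<in> {of_int k + (1 - \<rho>) / 2 .. of_int k + (1 + \<rho>) / 2}"
    using blocked_interval[of s t "\<lambda>u. fst (z u)"] assms by (auto simp: free_iff continuous_on_fst)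
  moreover obtain l where "\<forall>u\<in>{s..t}. snd (z u) \<in> {of_int l + (1 - \<rho>) / 2 .. of_int l + (1 + \<rho>) / 2}"
    using blocked_interval[of s t "\<lambda>u. snd (z u)"] assms by (auto simp: free_iff continuous_on_snd)
  ultimately show ?thesis
    using assms(1) by (intro exI[of _ k] exI[of _ l]) (simp add: obstacle_def mem_Times_iff)
qed

text \<open>At the last time up to which the bound holds it propagates: either the curve returns to the
  streets at times arbitrarily soon after, locally sharing a corridor, or it crosses one obstacle.\<close>

lemma street_dist_curve:
  fixes z :: "real \<Rightarrow> real \<times> real" and A :: "real \<Rightarrow> real"
  assumes z: "continuous_on {0..1} z" "z 0 = 0" and A: "continuous_on {0..1} A"
    and step: "\<And>s t. 0 \<le> s \<Longrightarrow> s \<le> t \<Longrightarrow> t \<le> 1 \<Longrightarrow> dist (z s) (z t) \<le> A t - A s"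
    and cross: "\<And>s t. 0 \<le> s \<Longrightarrow> s < t \<Longrightarrow> t \<le> 1 \<Longrightarrow> \<forall>u\<in>{s<..<t}. \<not> free (z u) \<Longrightarrow>
      2 * dist (z s) (z t) \<le> A t - A s"
    and t: "t \<in> {0..1}" "free (z t)"
  shows "street_dist (z t) \<le> A t - A 0"
proof (rule ccontr)
  assume contra: "\<not> street_dist (z t) \<le> A t - A 0"
  define D where "D = (\<lambda>u. street_dist (z u) - A u)"
  define T where "T = {u \<in> {0..1}. free (z u)}"
  have "closed ({0..1} \<inter> z -` {z. free z})"
    using z(1) closed_free by (intro continuous_closed_preimage) auto
  moreover have "T = {0..1} \<inter> z -` {z. free z}" by (auto simp: T_def)
  ultimately have "closed T" by simp
  have "continuous_on T (\<lambda>u. street_dist (z u))"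
    by (rule continuous_on_compose2[OF continuous_street_dist])
      (use z(1) in \<open>auto simp: T_def intro: continuous_on_subset\<close>)
  then have D: "continuous_on T D"
    unfolding D_def using A by (intro continuous_on_diff) (auto simp: T_def intro: continuous_on_subset)
  define S where "S = {0..t} \<inter> (T \<inter> D -` {.. - A 0})"
  have "compact S"
    unfolding S_def using \<open>closed T\<close> D
    by (intro compact_Int_closed continuous_closed_preimage) auto
  moreover have "0 \<in> S"
    using street_dist_zero near_zero t z(2) by (auto simp: S_def T_def D_def free_def)
  ultimately obtain b where b: "b \<in> S" "\<And>u. u \<in> S \<Longrightarrow> u \<le> b"
    using compact_attains_sup[of S] by auto
  have bT: "b \<in> T" "D b \<le> - A 0" "b \<le> t" "0 \<le> b" using b(1) by (auto simp: S_def)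
  have "b \<noteq> t" using bT contra by (auto simp: D_def)
  then have "b < t" using bT by simp
  have stop: False if u: "u \<in> T" "b < u" "u \<le> t" "street_dist (z u) \<le> street_dist (z b) + (A u - A b)" for u
  proof -
    have "D u \<le> - A 0" using u(4) bT(2) by (simp add: D_def)
    then have "u \<in> S" using u bT by (auto simp: S_def)
    from b(2)[OF this] u(2) show False by simp
  qed
  obtain r where r: "r > 0" "\<And>z'. free z' \<Longrightarrow> dist z' (z b) < r \<Longrightarrow> share (z b) z'"
    using share_locally[of "z b"] bT(1) unfolding T_def by auto
  have "b \<in> {0..1}" using bT(1) by (simp add: T_def)
  with z(1) r(1) obtain e where e: "e > 0" "\<And>u. u \<in> {0..1} \<Longrightarrow> dist u b < e \<Longrightarrow> dist (z u) (z b) < r"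
    unfolding continuous_on_iff by blast
  show False
  proof (cases "\<exists>u\<in>T. b < u \<and> u \<le> t \<and> u < b + e")
    case True
    then obtain u where u: "u \<in> T" "b < u" "u \<le> t" "u < b + e" by blast
    have "share (z b) (z u)" using u e(2)[of u] by (intro r(2)) (auto simp: T_def dist_real_def)
    from street_dist_share[OF this] step[of b u] u bT t(1) show False
      by (intro stop[of u]) auto
  next
    case False
    \<comment> \<open>No time of \<open>T\<close> up to \<open>t\<close> lies strictly between b and
      b + e, so the first one from b + e on is the first return after b. Until then the curve stays
      in a single obstacle.\<close>
    have "compact ({b + e..t} \<inter> T)" using \<open>closed T\<close> by (intro compact_Int_closed) auto
    moreover have "t \<in> {b + e..t} \<inter> T" using False \<open>b < t\<close> t by (auto simp: T_def)
    then have "{b + e..t} \<inter> T \<noteq> {}" by blast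
    ultimately have "\<exists>u\<in>{b + e..t} \<inter> T. \<forall>v\<in>{b + e..t} \<inter> T. u \<le> v"
      by (rule compact_attains_inf)
    then obtain u where u: "u \<in> {b + e..t} \<inter> T" "\<And>v. v \<in> {b + e..t} \<inter> T \<Longrightarrow> u \<le> v"
      by blast
    have bu: "b < u" "u \<le> t" "u \<in> T" using u(1) e(1) by auto
    have nf: "\<forall>v\<in>{b<..<u}. \<not> free (z v)"
    proof
      fix v assume v: "v \<in> {b<..<u}"
      show "\<not> free (z v)"
      proof
        assume "free (z v)"
        then have "v \<in> T" using v bT bu t(1) by (auto simp: T_def)
        moreover have "b + e \<le> v"
        proof (rule ccontr)
          assume "\<not> b + e \<le> v"
          then have "b < v \<and> v \<le> t \<and> v < b + e" using v bu by simp
          with False \<open>v \<in> T\<close> show False by blast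
        qed
        ultimately show False using u(2)[of v] v bu by simp
      qed
    qed
    have "continuous_on {b..u} z"
      by (rule continuous_on_subset[OF z(1)]) (use bT bu t(1) in auto)
    from obstacle_interval[OF bu(1) this nf] obtain k l where "z b \<in> obstacle k l" "z u \<in> obstacle k l"
      by blast
    then have "street_dist (z u) \<le> street_dist (z b) + 2 * dist (z b) (z u)"
      using bT bu by (intro street_dist_obstacle) (auto simp: T_def)
    with cross[OF bT(4) bu(1) _ nf] bu t(1) show False by (intro stop[of u]) auto
  qed
qed

end

subsection \<open>Calibration on a cone\<close>

text \<open>The linear functional \<open>(x, y) \<mapsto> slope_x * x + slope_y * y\<close> agrees with \<open>L_fun \<rho>\<close> on the cone
  \<open>n * y \<le> x \<le> (n + 1) * y\<close>.\<close>

locale street_cone = street_grid +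
  fixes n :: int
  assumes n_ge: "1 \<le> n"
begin

text \<open>The secant of \<open>ell \<rho>\<close> through n and n + 1 has slope
  \<open>slope_x\<close> and value \<open>offset\<close> at 0. Charging a horizontal step
  \<open>slope_x\<close> per crossing leaves \<open>offset\<close> over, which is attributed to the
  adjacent vertical step in \<open>slope_y\<close>.\<close>

definition slope_x :: real where "slope_x = ell \<rho> (of_int n + 1) - ell \<rho> (of_int n)"
definition offset :: real where "offset = ell \<rho> (of_int n) - of_int n * slope_x"
definition slope_y :: real where "slope_y = ell \<rho> 1 + offset"

text \<open>A convex function lies above its secant outside the interval between the two nodes, and
  no integer lies strictly between n and n + 1.\<close>

lemma ell_ge_affine: "offset + slope_x * of_int k \<le> ell \<rho> (of_int k)"
proof (cases "k \<le> n")
  case True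
  have "(1 + of_int (n - k)) * ell \<rho> (of_int n)
      \<le> 1 * ell \<rho> (of_int k) + of_int (n - k) * ell \<rho> (of_int n + 1)"
    by (rule ell_convex) (use True in \<open>auto simp: algebra_simps\<close>)
  then show ?thesis by (simp add: offset_def slope_x_def algebra_simps)
next
  case False
  have "(of_int (k - n - 1) + 1) * ell \<rho> (of_int n + 1)
      \<le> of_int (k - n - 1) * ell \<rho> (of_int n) + 1 * ell \<rho> (of_int k)"
    by (rule ell_convex) (use False in \<open>auto simp: algebra_simps\<close>)
  then show ?thesis by (simp add: offset_def slope_x_def algebra_simps)
qed

lemma slope_x_le: "slope_x \<le> 1"
  using ell_diff_le[of \<rho> "of_int n + 1" "of_int n"] by (simp add: slope_x_def)

lemma slope_x_ge: "diag \<le> slope_x"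
  using ell_increment_ge[of "of_int n"] n_ge by (simp add: slope_x_def)

lemma offset_le: "offset \<le> 0"
  using ell_ratio_mono[of "of_int n" "of_int n + 1"] n_ge
  by (simp add: offset_def slope_x_def algebra_simps)

lemma offset_ge: "- (1 - \<rho>) \<le> offset"
proof -
  have "of_int n * slope_x \<le> of_int n * 1"
    using slope_x_le n_ge by (intro mult_left_mono) auto
  then show ?thesis using ell_ge[of "of_int n"] by (simp add: offset_def)
qed

lemma slope_y_bounds: "0 \<le> slope_y" "slope_y \<le> 1"
  using ell_ge[of 1] ell_one_le offset_ge offset_le rho_gt by (auto simp: slope_y_def)

text \<open>Lower bounds, up to a common constant, for the length of a normal chain that ends at the
  offset \<open>w\<close> from the centre of a crossing: \<open>pot_v\<close> if its last step is vertical, \<open>pot_h\<close> if it is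
  horizontal. The two branches belong to an upward and to a downward vertical step, the one before
  \<open>w\<close> for \<open>pot_v\<close> and the one after \<open>w\<close> for \<open>pot_h\<close>.\<close>

definition pot_v :: "real \<times> real \<Rightarrow> real" where
  "pot_v w = min (diag * (fst w + snd w)) (offset + (1 - \<rho>) + diag * (fst w - snd w))"

definition pot_h :: "real \<times> real \<Rightarrow> real" where
  "pot_h w = max (offset + diag * (fst w + snd w)) (- (1 - \<rho>) + diag * (fst w - snd w))"

text \<open>For k > 0 the max and the min give four pairs of branches. If both neighbouring vertical
  steps go up or both go down, \<open>norm_ge_ell\<close> for b or - b and the secant bound suffice;
  the mixed pairs use \<open>norm_ge_flat\<close>, because the heights in the potentials then add up
  to at most \<open>1 - \<rho>\<close>.\<close>

lemma pot_horizontal_step: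
  assumes "crossing 0 0 w" "crossing 0 0 w'" "k \<noteq> 0"
  shows "pot_h w' - pot_v w + slope_x * of_int k \<le> norm (w' - w + (of_int k, 0))"
proof -
  define a b where "a = fst w' - fst w" and "b = snd w' - snd w"
  have ab: "\<bar>a\<bar> \<le> 1 - \<rho>" "\<bar>b\<bar> \<le> 1 - \<rho>" and sums: "\<bar>snd w + snd w'\<bar> \<le> 1 - \<rho>"
    using assms(1,2) unfolding crossing_def near_def a_def b_def by auto
  have w: "w' - w + (of_int k, 0) = (of_int k + a, b)"
    by (simp add: a_def b_def prod_eq_iff)
  have dsum: "diag * (snd w + snd w') \<le> diag * (1 - \<rho>)" "diag * - (snd w + snd w') \<le> diag * (1 - \<rho>)"
    using sums diag_bounds by (intro mult_left_mono; simp)+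
  have da: "diag * a = diag * fst w' - diag * fst w" "diag * b = diag * snd w' - diag * snd w"
    by (simp_all add: a_def b_def algebra_simps)
  show ?thesis
  proof (cases "k > 0")
    case True
    then have k: "1 \<le> (of_int k :: real)" by simp
    have 1: "ell \<rho> (of_int k) + diag * (a + b) \<le> norm (of_int k + a, b)"
      by (rule norm_ge_ell[OF k ab])
    have 2: "ell \<rho> (of_int k) + diag * (a - b) \<le> norm (of_int k + a, b)"
      using norm_ge_ell[OF k, of a "- b"] ab by (simp add: norm_Pair)
    have 3: "of_int k - (1 - \<rho>) + diag * (a + (1 - \<rho>)) \<le> norm (of_int k + a, b)"
      by (rule norm_ge_flat[OF ab(1)])
    have sk: "slope_x * of_int k \<le> of_int k"
      using slope_x_le k by (simp add: mult_le_cancel_right1)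
    note aff = ell_ge_affine[of k]
    have "pot_h w' - pot_v w + slope_x * of_int k \<le> norm (of_int k + a, b)"
      using 1 2 3 sk aff offset_ge dsum da unfolding pot_h_def pot_v_def min_def max_def
      by (simp add: distrib_left right_diff_distrib)
    then show ?thesis by (simp add: w)
  next
    case False
    \<comment> \<open>Backwards the left-hand side is nonpositive: the potentials differ by at most
      \<open>diag\<close>, because |a| and |b| are below 1 / 2, while
      \<open>slope_x * of_int k\<close> is at most \<open>- diag\<close>.\<close>
    then have k: "(of_int k :: real) \<le> -1" using assms(3) by simp
    have "- of_int k - a \<le> norm (of_int k + a, b)"
      using norm_fst_le[of "of_int k + a" b] by simp
    moreover have "slope_x * of_int k \<le> slope_x * (-1)"
      using k slope_x_ge diag_bounds by (intro mult_left_mono) auto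
    moreover have "diag * a \<le> diag * (1 - \<rho>)" "diag * b \<le> diag * (1 - \<rho>)" "diag * - b \<le> diag * (1 - \<rho>)"
      using ab diag_bounds by (intro mult_left_mono; simp)+
    moreover have "diag * (1 - \<rho>) \<le> diag * (1 / 2)"
      using rho_gt diag_bounds by (intro mult_left_mono) auto
    ultimately have "pot_h w' - pot_v w + slope_x * of_int k \<le> norm (of_int k + a, b)"
      using k ab(1) slope_x_ge offset_ge offset_le dsum da rho_gt unfolding pot_h_def pot_v_def min_def max_def
      by (simp add: distrib_left right_diff_distrib) linarith
    then show ?thesis by (simp add: w)
  qed
qed

text \<open>An upward step uses the first branches and a downward step the second ones. Upwards, a
  step over m crossings uses up one \<open>offset\<close> in the potentials, and the surplus m - 1
  of them has the favourable sign. Downwards, the constants \<open>1 - \<rho>\<close> in the two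
  branches are absorbed because \<open>1 - \<rho> \<le> ell \<rho> 1\<close>.\<close>

lemma pot_vertical_step:
  assumes "crossing 0 0 w" "crossing 0 0 w'" "m \<noteq> 0"
  shows "pot_v w' - pot_h w + slope_y * of_int m \<le> norm (w' - w + (0, of_int m))"
proof -
  define a b where "a = fst w' - fst w" and "b = snd w' - snd w"
  have ab: "\<bar>a\<bar> \<le> 1 - \<rho>" "\<bar>b\<bar> \<le> 1 - \<rho>"
    using assms(1,2) unfolding crossing_def near_def a_def b_def by auto
  have w: "w' - w + (0, of_int m) = (a, of_int m + b)"
    by (simp add: a_def b_def prod_eq_iff)
  have da: "diag * (a + b) = diag * (fst w' + snd w') - diag * (fst w + snd w)"
     "diag * (a - b) = diag * (fst w' - snd w') - diag * (fst w - snd w)"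
    by (simp_all add: a_def b_def algebra_simps)
  show ?thesis
  proof (cases "m > 0")
    case True
    then have m: "1 \<le> (of_int m :: real)" by simp
    have "ell \<rho> (of_int m) + diag * (b + a) \<le> norm (of_int m + b, a)"
      by (rule norm_ge_ell[OF m ab(2,1)])
    moreover have "of_int m * ell \<rho> 1 \<le> ell \<rho> (of_int m)"
      using ell_ratio_mono[of 1 "of_int m"] m by simp
    moreover have "(of_int m - 1) * offset \<le> 0"
      using m offset_le by (simp add: mult_nonneg_nonpos)
    ultimately have "pot_v w' - pot_h w + slope_y * of_int m \<le> norm (of_int m + b, a)"
      using da(1) unfolding pot_h_def pot_v_def slope_y_def
      by (simp add: algebra_simps)
    then show ?thesis by (simp add: w norm_real_Pair_commute)
  next
    case False
    define k where "k = - m"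
    have k: "1 \<le> (of_int k :: real)" and mk: "(of_int m :: real) = - of_int k"
      using False assms(3) by (simp_all add: k_def)
    have "ell \<rho> (of_int k) + diag * (- b + a) \<le> norm (of_int k + - b, a)"
      by (rule norm_ge_ell[OF k]) (use ab in auto)
    moreover have "norm (of_int k + - b, a) = norm (a, of_int m + b)"
      by (simp add: mk norm_Pair power2_commute add.commute)
    moreover have "of_int k * ell \<rho> 1 \<le> ell \<rho> (of_int k)"
      using ell_ratio_mono[of 1 "of_int k"] k by simp
    moreover have pos: "1 - \<rho> \<le> ell \<rho> 1" using ell_ge[of 1] rho_gt by simp
    moreover have "1 * (2 * ell \<rho> 1 + offset) \<le> of_int k * (2 * ell \<rho> 1 + offset)"
      using k pos offset_ge rho_lt by (intro mult_right_mono) auto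
    ultimately have "pot_v w' - pot_h w + slope_y * of_int m \<le> norm (a, of_int m + b)"
      using da(2) unfolding pot_h_def pot_v_def slope_y_def mk
      by (simp add: algebra_simps)
    then show ?thesis by (simp add: w)
  qed
qed

section \<open>Telescoping the potentials along chains\<close>

abbreviation node :: "int \<Rightarrow> int \<Rightarrow> real \<times> real" where
  "node i j \<equiv> (of_int i, of_int j)"

lemma crossing_shift: "crossing i j z \<longleftrightarrow> crossing 0 0 (z - node i j)"
  by (simp add: crossing_def near_def)

lemma pot_start:
  assumes "crossing 0 0 z"
  shows "pot_v z \<le> norm z + 2" "pot_h z \<le> norm z + 2"
proof -
  have xy: "fst z \<le> 1 / 4" "snd z \<le> 1 / 4" "- snd z \<le> 1 / 4"
    using assms rho_gt unfolding crossing_def near_def by auto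
  define p r where "p = fst z + snd z" and "r = fst z - snd z"
  have "diag * p \<le> diag * 1" "diag * r \<le> diag * 1"
    using diag_bounds xy unfolding p_def r_def by (intro mult_left_mono; simp)+
  then have "diag * p \<le> 1" "diag * r \<le> 1" using diag_bounds by linarith+
  then show "pot_v z \<le> norm z + 2" "pot_h z \<le> norm z + 2"
    using offset_le rho_gt rho_lt norm_ge_zero[of z]
    unfolding pot_v_def pot_h_def p_def[symmetric] r_def[symmetric] by linarith+
qed

text \<open>The step inequalities telescope because steps alternate: a horizontal step begins with
  \<open>pot_v\<close> and ends with \<open>pot_h\<close>, a vertical one conversely. The 2 covers
  the potential at the start.\<close>

lemma normal_chain_cost:
  assumes "normal_chain h i j z c"
  shows "(if h then pot_h (z - node i j) else pot_v (z - node i j))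
    + slope_x * of_int i + slope_y * of_int j \<le> c + 2"
  using assms
proof (induction rule: normal_chain.induct)
  case (start z c h)
  then show ?case using pot_start[of z] by (simp add: zero_prod_def[symmetric])
next
  case (horizontal i j w c i' z)
  have "pot_h (z - node i' j) - pot_v (w - node i j) + slope_x * of_int (i' - i)
      \<le> norm ((z - node i' j) - (w - node i j) + (of_int (i' - i), 0))"
    using horizontal normal_chain_crossing[OF horizontal.hyps(1)]
    by (intro pot_horizontal_step) (auto simp: crossing_shift[of i' j z] crossing_shift[of i j w])
  also have "(z - node i' j) - (w - node i j) + (of_int (i' - i), 0) = z - w"
    by (simp add: prod_eq_iff)
  finally show ?case using horizontal.IH by (simp add: dist_norm norm_minus_commute algebra_simps)
next
  case (vertical i j w c j' z)
  have "pot_v (z - node i j') - pot_h (w - node i j) + slope_y * of_int (j' - j)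
      \<le> norm ((z - node i j') - (w - node i j) + (0, of_int (j' - j)))"
    using vertical normal_chain_crossing[OF vertical.hyps(1)]
    by (intro pot_vertical_step) (auto simp: crossing_shift[of i j' z] crossing_shift[of i j w])
  also have "(z - node i j') - (w - node i j) + (0, of_int (j' - j)) = z - w"
    by (simp add: prod_eq_iff)
  finally show ?case using vertical.IH by (simp add: dist_norm norm_minus_commute algebra_simps)
qed

text \<open>The 6 consists of 2 from the start of the chain, 2 from the potential at its end and 2
  from the last segment. For that segment the distance pays for one coordinate, since in the other
  one a shared corridor keeps the difference within 1 / 2.\<close>

lemma street_dist_ge:
  assumes "free z"
  shows "slope_x * fst z + slope_y * snd z - 6 \<le> street_dist z"
  using assms
proof (rule street_dist_greatest)
  fix h i j w c
  assume chain: "normal_chain h i j w c" and ij: "near (fst z) i \<or> near (snd z) j"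
  have crossing: "crossing 0 0 (w - node i j)"
    using normal_chain_crossing[OF chain] crossing_shift by simp
  then have xy: "\<bar>fst w - of_int i\<bar> \<le> 1 / 4" "\<bar>snd w - of_int j\<bar> \<le> 1 / 4"
    using rho_gt unfolding crossing_def near_def by auto
  have sx: "0 \<le> slope_x" using slope_x_ge diag_bounds by simp
  have pot: "- 2 \<le> (if h then pot_h (w - node i j) else pot_v (w - node i j))"
  proof -
    define p r where "p = fst (w - node i j) + snd (w - node i j)" and "r = fst (w - node i j) - snd (w - node i j)"
    have "\<bar>p\<bar> \<le> 1 / 2" "\<bar>r\<bar> \<le> 1 / 2" using xy unfolding p_def r_def fst_diff snd_diff fst_conv snd_conv by linarith+
    then have "- (1 / 2) \<le> diag * p" "- (1 / 2) \<le> diag * r"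
      using scale_le_abs[of diag "- p"] scale_le_abs[of diag "- r"] diag_bounds by auto
    then show ?thesis
      using offset_ge rho_gt unfolding pot_h_def pot_v_def p_def[symmetric] r_def[symmetric]
      by (auto simp: min_def max_def)
  qed
  have d: "\<bar>fst z - fst w\<bar> \<le> dist w z" "\<bar>snd z - snd w\<bar> \<le> dist w z"
    using dist_fst_le[of w z] dist_snd_le[of w z] by (auto simp: dist_real_def)
  have small: "\<bar>fst z - fst w\<bar> \<le> 1 / 2 \<or> \<bar>snd z - snd w\<bar> \<le> 1 / 2"
    using ij
  proof
    assume "near (fst z) i"
    then have "\<bar>fst z - of_int i\<bar> \<le> 1 / 4" using rho_gt unfolding near_def by simp
    then have "\<bar>fst z - fst w\<bar> \<le> 1 / 2" using xy(1) by linarith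
    then show ?thesis ..
  next
    assume "near (snd z) j"
    then have "\<bar>snd z - of_int j\<bar> \<le> 1 / 4" using rho_gt unfolding near_def by simp
    then have "\<bar>snd z - snd w\<bar> \<le> 1 / 2" using xy(2) by linarith
    then show ?thesis ..
  qed
  have "slope_x * (fst z - of_int i) + slope_y * (snd z - of_int j) \<le> \<bar>fst z - of_int i\<bar> + \<bar>snd z - of_int j\<bar>"
    by (intro add_mono scale_le_abs sx slope_x_le slope_y_bounds)
  also have "\<dots> \<le> dist w z + 2" using d small xy by linarith
  finally show "slope_x * fst z + slope_y * snd z - 6 \<le> c + dist w z"
    using normal_chain_cost[OF chain] pot by (simp add: algebra_simps)
qed

text \<open>The curve may end inside an obstacle. It is then stopped at its last free time; from
  there to the end each coordinate changes by at most 1, which turns 6 into 8.\<close>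

lemma curve_cost_ge:
  fixes z :: "real \<Rightarrow> real \<times> real" and A :: "real \<Rightarrow> real"
  assumes z: "continuous_on {0..1} z" "z 0 = 0" and A: "continuous_on {0..1} A"
    and step: "\<And>s t. 0 \<le> s \<Longrightarrow> s \<le> t \<Longrightarrow> t \<le> 1 \<Longrightarrow> dist (z s) (z t) \<le> A t - A s"
    and cross: "\<And>s t. 0 \<le> s \<Longrightarrow> s < t \<Longrightarrow> t \<le> 1 \<Longrightarrow> \<forall>u\<in>{s<..<t}. \<not> free (z u) \<Longrightarrow>
      2 * dist (z s) (z t) \<le> A t - A s"
  shows "slope_x * fst (z 1) + slope_y * snd (z 1) - 8 \<le> A 1 - A 0"
proof -
  define T where "T = {0..1} \<inter> z -` {z. free z}"
  have "closed T"
    unfolding T_def using z(1) closed_free by (intro continuous_closed_preimage) auto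
  then have "compact ({0..1} \<inter> T)" by (intro compact_Int_closed) auto
  moreover have "0 \<in> {0..1} \<inter> T" using near_zero z(2) by (auto simp: T_def free_def)
  then have "{0..1} \<inter> T \<noteq> {}" by blast
  ultimately have "\<exists>t\<in>{0..1} \<inter> T. \<forall>u\<in>{0..1} \<inter> T. u \<le> t"
    by (rule compact_attains_sup)
  then obtain t where t: "t \<in> {0..1} \<inter> T" "\<And>u. u \<in> {0..1} \<inter> T \<Longrightarrow> u \<le> t"
    by blast
  have t': "t \<in> {0..1}" "free (z t)" using t(1) by (auto simp: T_def)
  have "street_dist (z t) \<le> A t - A 0"
    by (rule street_dist_curve[OF z A step cross t'])
  then have lower: "slope_x * fst (z t) + slope_y * snd (z t) - 6 \<le> A t - A 0"
    using street_dist_ge[OF t'(2)] by linarith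
  have mono: "A t \<le> A 1" using order_trans[OF zero_le_dist step[of t 1]] t'(1) by simp
  have "\<bar>fst (z 1) - fst (z t)\<bar> \<le> 1 \<and> \<bar>snd (z 1) - snd (z t)\<bar> \<le> 1"
  proof (cases "t = 1")
    case False
    then have "t < 1" using t' by simp
    have "\<forall>u\<in>{t<..<1}. \<not> free (z u)" 
    proof (intro ballI notI)
      fix u assume "u \<in> {t<..<1}" "free (z u)"
      then show False using t(2)[of u] t'(1) by (simp add: T_def)
    qed
    moreover have "continuous_on {t..1} z"
      by (rule continuous_on_subset[OF z(1)]) (use t' in auto)
    ultimately have "\<exists>k l. z t \<in> obstacle k l \<and> z 1 \<in> obstacle k l"
      by (intro obstacle_interval[OF \<open>t < 1\<close>])
    then obtain k l where "z t \<in> obstacle k l" "z 1 \<in> obstacle k l" by blast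
    then have "\<bar>fst (z 1) - fst (z t)\<bar> \<le> \<rho>" "\<bar>snd (z 1) - snd (z t)\<bar> \<le> \<rho>"
      unfolding obstacle_def mem_Times_iff atLeastAtMost_iff by (simp_all add: abs_le_iff field_simps)
    with rho_lt show ?thesis by linarith
  qed simp
  moreover have "slope_x * (fst (z 1) - fst (z t)) \<le> \<bar>fst (z 1) - fst (z t)\<bar>"
    "slope_y * (snd (z 1) - snd (z t)) \<le> \<bar>snd (z 1) - snd (z t)\<bar>"
    using slope_x_le slope_x_ge diag_bounds slope_y_bounds by (intro scale_le_abs; linarith)+
  ultimately show ?thesis using lower mono unfolding right_diff_distrib by linarith
qed

end

subsection \<open>Weighted length and competitors\<close>

text \<open>Integration by parts: the fundamental theorem with finitely many exceptional points
  applies to the product of \<open>\<phi>\<close> and \<open>f\<close>, whose boundary values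
  vanish.\<close>

lemma weak_derivative_piecewise:
  fixes f g :: "real \<Rightarrow> 'a::euclidean_space"
  assumes f: "continuous_on {0..1} f" and S: "finite S"
    and deriv: "\<And>t. t \<in> {0<..<1} - S \<Longrightarrow> (f has_vector_derivative g t) (at t)"
    and g: "g absolutely_integrable_on {0..1}"
  shows "weak_derivative f g"
  unfolding weak_derivative_def
proof (intro conjI ballI)
  show g': "set_integrable lebesgue {0<..<1} g"
    using g by (simp add: absolutely_integrable_on_Icc_iff_Ioo)
  fix \<phi> assume \<phi>: "\<phi> \<in> test_functions"
  then have "((deriv ^^ 0) \<phi>) differentiable (at t)" "((deriv ^^ 1) \<phi>) differentiable (at t)" for t
    unfolding test_functions_def by blast+
  then have D: "(\<phi> has_real_derivative deriv \<phi> t) (at t)" and D': "isCont (deriv \<phi>) t" for t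
    by (auto simp: DERIV_deriv_iff_real_differentiable differentiable_imp_continuous_within)
  have cont: "continuous_on {0..1} \<phi>" "continuous_on {0..1} (deriv \<phi>)"
    using D' by (auto intro!: continuous_at_imp_continuous_on DERIV_isCont[OF D])
  have ends: "\<phi> 0 = 0" "\<phi> 1 = 0"
    using \<phi> closure_subset[of "{t. \<phi> t \<noteq> 0}"] unfolding test_functions_def by force+
  have "((\<lambda>t. \<phi> t *\<^sub>R g t + deriv \<phi> t *\<^sub>R f t) has_integral (\<phi> 1 *\<^sub>R f 1 - \<phi> 0 *\<^sub>R f 0)) {0..1}"
  proof (rule fundamental_theorem_of_calculus_interior_strong[OF S])
    show "((\<lambda>t. \<phi> t *\<^sub>R f t) has_vector_derivative \<phi> t *\<^sub>R g t + deriv \<phi> t *\<^sub>R f t) (at t)"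
      if "t \<in> {0<..<1} - S" for t
      by (rule has_vector_derivative_scaleR[OF D deriv[OF that]])
    show "continuous_on {0..1} (\<lambda>t. \<phi> t *\<^sub>R f t)" by (intro continuous_intros cont f)
  qed simp
  then have sum: "integral {0..1} (\<lambda>t. \<phi> t *\<^sub>R g t + deriv \<phi> t *\<^sub>R f t) = 0"
    by (simp add: ends integral_unique)
  obtain B where B: "\<And>t. t \<in> {0..1} \<Longrightarrow> norm (\<phi> t) \<le> B"
    using compact_imp_bounded[OF compact_continuous_image[OF cont(1) compact_Icc]]
    unfolding bounded_iff by blast
  have "set_integrable lebesgue {0<..<1} (\<lambda>t. \<phi> t *\<^sub>R g t)"
    by (rule set_integrable_bounded_scaleR[OF g' set_borel_measurable_continuous[OF cont(1)], of B])
      (use B in auto)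
  note \<phi>g = absolutely_integrable_Icc[OF this]
  have int_f: "(\<lambda>t. deriv \<phi> t *\<^sub>R f t) absolutely_integrable_on {0..1}"
    by (intro absolutely_integrable_continuous_real continuous_intros cont f)
  then have "set_integrable lebesgue {0<..<1} (\<lambda>t. deriv \<phi> t *\<^sub>R f t)"
    by (simp add: absolutely_integrable_on_Icc_iff_Ioo)
  note \<phi>f = absolutely_integrable_Icc[OF this]
  have "integral {0..1} (\<lambda>t. \<phi> t *\<^sub>R g t) + integral {0..1} (\<lambda>t. deriv \<phi> t *\<^sub>R f t) = 0"
    using sum \<phi>g(1) int_f by (subst integral_add[symmetric]) (auto simp: absolutely_integrable_on_def)
  then show "(LINT t:{0<..<1}|lebesgue. deriv \<phi> t *\<^sub>R f t) = - (LINT t:{0<..<1}|lebesgue. \<phi> t *\<^sub>R g t)"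
    unfolding \<phi>g(3) \<phi>f(3) by (simp add: eq_neg_iff_add_eq_0 add.commute)
qed

text \<open>The left inverse \<open>T'\<close> lets \<open>T\<close> commute with the integral
  regardless of integrability, so the defining identity can be moved through \<open>T\<close> as it
  stands.\<close>

lemma weak_derivative_bounded_linear:
  fixes T T' :: "'a::euclidean_space \<Rightarrow> 'a"
  assumes T: "bounded_linear T" and T': "bounded_linear T'" "\<And>x. T' (T x) = x"
    and weak: "weak_derivative f g"
  shows "weak_derivative (\<lambda>t. T (f t)) (\<lambda>t. T (g t))"
  unfolding weak_derivative_def
proof (intro conjI ballI)
  interpret T: bounded_linear T by fact
  have set_integral: "(LINT t:S|lebesgue. c t *\<^sub>R T (h t)) = T (LINT t:S|lebesgue. c t *\<^sub>R h t)"
    for S and c :: "real \<Rightarrow> real" and h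
  proof -
    have "(\<lambda>t. indicator S t *\<^sub>R c t *\<^sub>R T (h t)) = (\<lambda>t. T (indicator S t *\<^sub>R c t *\<^sub>R h t))"
      by (simp add: T.scaleR)
    then show ?thesis
      unfolding set_lebesgue_integral_def by (simp only:) (rule integral_bounded_linear'[OF T T'(1)], simp add: T')
  qed
  have "(\<lambda>t. indicator {0<..<1} t *\<^sub>R T (g t)) = (\<lambda>t. T (indicator {0<..<1} t *\<^sub>R g t))"
    by (simp add: T.scaleR)
  then show "set_integrable lebesgue {0<..<1} (\<lambda>t. T (g t))"
    using weak unfolding weak_derivative_def set_integrable_def by (simp add: integrable_bounded_linear[OF T])
  fix \<phi> assume "\<phi> \<in> test_functions"
  then show "(LINT t:{0<..<1}|lebesgue. deriv \<phi> t *\<^sub>R T (f t)) = - (LINT t:{0<..<1}|lebesgue. \<phi> t *\<^sub>R T (g t))"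
    using weak unfolding weak_derivative_def set_integral by (simp add: linear_neg[OF bounded_linear.linear[OF T]])
qed

text \<open>Composition with \<open>T\<close> includes the lengths for \<open>\<xi>\<close> among
  those for \<open>T \<xi>\<close>. As \<open>T\<close> is an involution, the same inclusion at
  \<open>T \<xi>\<close> is the converse.\<close>

lemma min_length_isometry:
  assumes T: "bounded_linear T" "\<And>z. T (T z) = z" "\<And>z. norm (T z) = norm z"
    and a: "\<And>z. a_coeff \<rho> \<beta> (T z) = a_coeff \<rho> \<beta> z"
  shows "min_length \<rho> \<beta> \<epsilon> (T \<xi>) = min_length \<rho> \<beta> \<epsilon> \<xi>"
proof -
  interpret T: bounded_linear T by fact
  have sub: "{weighted_length \<rho> \<beta> \<epsilon> \<gamma> g | \<gamma> g. \<gamma> \<in> W11_joining 0 \<xi> \<and> weak_derivative \<gamma> g}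
      \<subseteq> {weighted_length \<rho> \<beta> \<epsilon> \<gamma> g | \<gamma> g. \<gamma> \<in> W11_joining 0 (T \<xi>) \<and> weak_derivative \<gamma> g}" for \<xi>
  proof clarify
    fix \<gamma> g assume \<gamma>: "\<gamma> \<in> W11_joining 0 \<xi>" and g: "weak_derivative \<gamma> g"
    have weak: "weak_derivative (\<lambda>t. T (\<gamma> t)) (\<lambda>t. T (g t))"
      by (rule weak_derivative_bounded_linear[OF T(1,1,2) g])
    have "(\<lambda>t. indicator {0<..<1} t *\<^sub>R T (\<gamma> t)) = (\<lambda>t. T (indicator {0<..<1} t *\<^sub>R \<gamma> t))"
      by (simp add: T.scaleR)
    then have "set_integrable lebesgue {0<..<1} (\<lambda>t. T (\<gamma> t))"
      using \<gamma> unfolding W11_joining_def W11_def set_integrable_def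
      by (simp add: integrable_bounded_linear[OF T(1)])
    with weak \<gamma> have "(\<lambda>t. T (\<gamma> t)) \<in> W11_joining 0 (T \<xi>)"
      unfolding W11_joining_def W11_def by (auto simp: T.zero intro: T.continuous_on)
    moreover have "weighted_length \<rho> \<beta> \<epsilon> (\<lambda>t. T (\<gamma> t)) (\<lambda>t. T (g t)) = weighted_length \<rho> \<beta> \<epsilon> \<gamma> g"
      unfolding weighted_length_def T.scaleR[symmetric] a T(3) ..
    ultimately show "\<exists>\<gamma>' g'. weighted_length \<rho> \<beta> \<epsilon> \<gamma> g = weighted_length \<rho> \<beta> \<epsilon> \<gamma>' g' \<and>
        \<gamma>' \<in> W11_joining 0 (T \<xi>) \<and> weak_derivative \<gamma>' g'"
      using weak by metis
  qed
  show ?thesis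
    unfolding min_length_def using sub[of \<xi>] sub[of "T \<xi>"] by (simp add: T(2) subset_antisym)
qed

locale weighted_grid = street_grid +
  fixes \<beta> :: real
  assumes beta_gt: "2 < \<beta>"
begin

section \<open>Lower bound for the weighted length\<close>

abbreviation weight :: "real \<times> real \<Rightarrow> real" where "weight \<equiv> a_coeff \<rho> \<beta>"

lemma weight_eq: "weight z = (if free z then 1 else \<beta>)"
  by (auto simp: a_coeff_def free_iff blocked_def)

lemma weight_bounds: "1 \<le> weight z" "weight z \<le> \<beta>"
  using beta_gt by (auto simp: weight_eq)

lemma weight_abs_le: "\<bar>weight z\<bar> \<le> \<beta>"
  using weight_bounds[of z] by simp

lemma weight_measurable: "weight \<in> borel_measurable borel"
proof -
  have "(\<lambda>z. if z \<in> {z. free z} then 1 else \<beta>) \<in> borel_measurable borel"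
    using borel_closed[OF closed_free] by (intro measurable_If_set) auto
  then show ?thesis by (simp add: weight_eq[abs_def])
qed

lemma set_borel_measurable_weight:
  fixes z :: "real \<Rightarrow> real \<times> real"
  assumes "continuous_on S z" "S \<in> sets borel"
  shows "set_borel_measurable lebesgue S (\<lambda>t. weight (z t))"
proof -
  have "(\<lambda>t. indicator S t *\<^sub>R z t) \<in> borel_measurable borel"
    using assms by (intro borel_measurable_continuous_on_indicator)
  then have "(\<lambda>t. weight (indicator S t *\<^sub>R z t)) \<in> borel_measurable borel"
    by (rule measurable_compose[OF _ weight_measurable])
  then have "(\<lambda>t. indicator S t *\<^sub>R weight (indicator S t *\<^sub>R z t)) \<in> borel_measurable borel"
    using assms(2) by (intro borel_measurable_scaleR borel_measurable_indicator)
  moreover have "(\<lambda>t. indicator S t *\<^sub>R weight (indicator S t *\<^sub>R z t)) = (\<lambda>t. indicator S t *\<^sub>R weight (z t))"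
    by (auto simp: indicator_def)
  ultimately show ?thesis
    unfolding set_borel_measurable_def by (simp add: measurable_completion)
qed

lemma set_integrable_weight:
  fixes z g :: "real \<Rightarrow> real \<times> real"
  assumes z: "continuous_on S z" "S \<in> sets borel" and g: "set_integrable lebesgue S g"
  shows "set_integrable lebesgue S (\<lambda>t. weight (z t) * norm (g t))"
proof -
  have "set_integrable lebesgue S (\<lambda>t. norm (g t))"
    using integrable_norm[OF g[unfolded set_integrable_def]] by (simp add: set_integrable_def)
  then have "set_integrable lebesgue S (\<lambda>t. weight (z t) *\<^sub>R norm (g t))"
    by (rule set_integrable_bounded_scaleR[OF _ set_borel_measurable_weight[OF z], of _ \<beta>])
      (rule weight_abs_le)
  then show ?thesis by simp
qed

text \<open>\<open>A\<close> is the weighted length accumulated up to a given time. The last claim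
  looks at the weight on the open interval only, because a passage through an obstacle may begin and
  end on its boundary, where the weight is 1. It is applied with k = 1 and k = 2.\<close>

lemma weighted_length_increments:
  fixes \<epsilon> :: real
  assumes \<gamma>: "continuous_on {0..1} \<gamma>" and weak: "weak_derivative \<gamma> g"
  defines "A \<equiv> \<lambda>t. integral {0..t} (\<lambda>t. weight ((1 / \<epsilon>) *\<^sub>R \<gamma> t) * norm (g t))"
  shows "continuous_on {0..1} A" "weighted_length \<rho> \<beta> \<epsilon> \<gamma> g = A 1"
    "\<And>s t k. 0 \<le> s \<Longrightarrow> s \<le> t \<Longrightarrow> t \<le> 1 \<Longrightarrow> 0 \<le> k \<Longrightarrow>
      \<forall>u\<in>{s<..<t}. k \<le> weight ((1 / \<epsilon>) *\<^sub>R \<gamma> u) \<Longrightarrow> k * norm (\<gamma> t - \<gamma> s) \<le> A t - A s"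
proof -
  define H where "H = (\<lambda>t. weight ((1 / \<epsilon>) *\<^sub>R \<gamma> t) * norm (g t))"
  have g: "set_integrable lebesgue {0<..<1} g" using weak by (simp add: weak_derivative_def)
  have "continuous_on {0<..<1} (\<lambda>t. (1 / \<epsilon>) *\<^sub>R \<gamma> t)"
    by (intro continuous_intros continuous_on_subset[OF \<gamma>]) auto
  then have "set_integrable lebesgue {0<..<1} H"
    unfolding H_def by (rule set_integrable_weight) (use g in auto)
  note H = absolutely_integrable_Icc[OF this]
  have H_int: "H integrable_on {0..1}" using H(1) by (simp add: absolutely_integrable_on_def)
  have A_eq: "A = (\<lambda>t. integral {0..t} H)" by (simp add: A_def H_def)
  show "continuous_on {0..1} A"
    unfolding A_eq using H_int by (rule indefinite_integral_continuous_1)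
  show "weighted_length \<rho> \<beta> \<epsilon> \<gamma> g = A 1"
    using H(3) unfolding weighted_length_def A_eq H_def .
  fix s t k :: real
  assume st: "0 \<le> s" "s \<le> t" "t \<le> 1" and k: "0 \<le> k" "\<forall>u\<in>{s<..<t}. k \<le> weight ((1 / \<epsilon>) *\<^sub>R \<gamma> u)"
  define N where "N = (\<lambda>t. norm (g t))"
  have N_int: "N integrable_on {0..1}" unfolding N_def by (rule absolutely_integrable_Icc(2)[OF g])
  have diff: "integral {s..t} F = integral {0..t} F - integral {0..s} F" if "F integrable_on {0..1}" for F :: "real \<Rightarrow> real"
    using Henstock_Kurzweil_Integration.integral_combine[where a = 0 and c = s and b = t and f = F] st
      integrable_on_subinterval[OF that, of 0 t] by simp
  have sub: "F integrable_on {s<..<t}" if "F integrable_on {0..1}" for F :: "real \<Rightarrow> real"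
    using integrable_on_subinterval[OF that, of s t] st by (simp add: integrable_on_open_interval_real)
  have "k * norm (\<gamma> t - \<gamma> s) \<le> k * integral {s..t} N"
    using weak_derivative_increment[OF weak \<gamma> st] diff[OF N_int] k(1) unfolding N_def
    by (intro mult_left_mono) auto
  also have "\<dots> = integral {s<..<t} (\<lambda>u. k * N u)"
    by (simp add: integral_open_interval_real)
  also have "\<dots> \<le> integral {s<..<t} H"
  proof (rule integral_le)
    show "(\<lambda>u. k * N u) integrable_on {s<..<t}" using sub[OF N_int] by (rule integrable_on_mult_right)
    show "H integrable_on {s<..<t}" by (rule sub[OF H_int])
    show "k * N u \<le> H u" if "u \<in> {s<..<t}" for u
      unfolding H_def N_def using k(2) that by (intro mult_right_mono) auto
  qed
  also have "\<dots> = A t - A s"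
    using diff[OF H_int] by (simp add: A_eq integral_open_interval_real)
  finally show "k * norm (\<gamma> t - \<gamma> s) \<le> A t - A s" .
qed

lemma norm_le_weighted_length:
  assumes "\<gamma> \<in> W11_joining 0 \<xi>" "weak_derivative \<gamma> g"
  shows "norm \<xi> \<le> weighted_length \<rho> \<beta> \<epsilon> \<gamma> g"
proof -
  have "continuous_on {0..1} \<gamma>" "\<gamma> 0 = 0" "\<gamma> 1 = \<xi>" using assms(1) by (auto simp: W11_joining_def)
  then show ?thesis
    using weighted_length_increments(2)[OF _ assms(2), where \<epsilon> = \<epsilon>] weight_bounds(1)
      weighted_length_increments(3)[OF _ assms(2), where k = 1 and s = 0 and t = 1 and \<epsilon> = \<epsilon>]
    by simp
qed

text \<open>Curve and accumulated length are both divided by \<epsilon>, and scaling back turns the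
  constant 8 into 8 \<epsilon>. The factor 2 that \<open>curve_cost_ge\<close> asks for inside
  obstacles comes from \<beta> > 2.\<close>

lemma weighted_length_ge:
  assumes \<gamma>: "\<gamma> \<in> W11_joining 0 \<xi>" and weak: "weak_derivative \<gamma> g" and \<epsilon>: "0 < \<epsilon>" and n: "1 \<le> n"
  shows "street_cone.slope_x \<rho> n * fst \<xi> + street_cone.slope_y \<rho> n * snd \<xi> - 8 * \<epsilon>
    \<le> weighted_length \<rho> \<beta> \<epsilon> \<gamma> g"
proof -
  interpret street_cone \<rho> n by standard (rule n)
  have cont: "continuous_on {0..1} \<gamma>" and ends: "\<gamma> 0 = 0" "\<gamma> 1 = \<xi>"
    using \<gamma> by (auto simp: W11_joining_def)
  define A where "A = (\<lambda>t. integral {0..t} (\<lambda>t. weight ((1 / \<epsilon>) *\<^sub>R \<gamma> t) * norm (g t)))"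
  have A_eq: "integral {0..t} (\<lambda>t. weight ((1 / \<epsilon>) *\<^sub>R \<gamma> t) * norm (g t)) = A t" for t
    by (simp add: A_def)
  note inc = weighted_length_increments[OF cont weak, where \<epsilon> = \<epsilon>, unfolded A_eq]
  define z where "z = (\<lambda>t. (1 / \<epsilon>) *\<^sub>R \<gamma> t)"
  have dist_z: "k * dist (z s) (z t) = (1 / \<epsilon>) * (k * norm (\<gamma> t - \<gamma> s))" for k s t
    using \<epsilon> by (simp add: z_def dist_norm scaleR_diff_right[symmetric] norm_minus_commute)
  have "slope_x * fst (z 1) + slope_y * snd (z 1) - 8 \<le> (1 / \<epsilon>) * A 1 - (1 / \<epsilon>) * A 0"
  proof (rule curve_cost_ge)
    show "continuous_on {0..1} z" unfolding z_def by (intro continuous_intros cont)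
    show "z 0 = 0" by (simp add: z_def ends)
    show "continuous_on {0..1} (\<lambda>t. (1 / \<epsilon>) * A t)" by (intro continuous_intros inc(1))
    show "dist (z s) (z t) \<le> (1 / \<epsilon>) * A t - (1 / \<epsilon>) * A s" if "0 \<le> s" "s \<le> t" "t \<le> 1" for s t
    proof -
      have "1 * norm (\<gamma> t - \<gamma> s) \<le> A t - A s"
        using that weight_bounds(1) by (intro inc(3)) auto
      from mult_left_mono[OF this, of "1 / \<epsilon>"] \<epsilon> show ?thesis
        using dist_z[of 1 s t] by (simp add: right_diff_distrib)
    qed
    show "2 * dist (z s) (z t) \<le> (1 / \<epsilon>) * A t - (1 / \<epsilon>) * A s"
      if "0 \<le> s" "s < t" "t \<le> 1" "\<forall>u\<in>{s<..<t}. \<not> free (z u)" for s t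
    proof -
      have "2 * norm (\<gamma> t - \<gamma> s) \<le> A t - A s"
        using that beta_gt by (intro inc(3)) (auto simp: weight_eq z_def)
      from mult_left_mono[OF this, of "1 / \<epsilon>"] \<epsilon> show ?thesis
        using dist_z[of 2 s t] by (simp add: right_diff_distrib)
    qed
  qed
  from mult_left_mono[OF this, of \<epsilon>] show ?thesis
    using \<epsilon> by (simp add: inc(2) z_def ends A_def algebra_simps)
qed

text \<open>Integrability of the weighted speed is demanded along with the bound, because
  \<open>integral\<close> is 0 for functions that are not integrable and the bound would then say
  nothing. The finite set \<open>S\<close> admits the corners of polygons.\<close>

definition travel :: "real \<Rightarrow> real \<Rightarrow> real \<Rightarrow> real \<times> real \<Rightarrow> real \<times> real \<Rightarrow> real \<Rightarrow> bool" where
  "travel \<epsilon> a b p q c \<longleftrightarrow> (\<exists>\<gamma> g S.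
     continuous_on {a..b} \<gamma> \<and> \<gamma> a = p \<and> \<gamma> b = q \<and> finite S \<and>
     (\<forall>t\<in>{a<..<b} - S. (\<gamma> has_vector_derivative g t) (at t)) \<and>
     g absolutely_integrable_on {a..b} \<and>
     (\<lambda>t. weight ((1 / \<epsilon>) *\<^sub>R \<gamma> t) * norm (g t)) integrable_on {a..b} \<and>
     integral {a..b} (\<lambda>t. weight ((1 / \<epsilon>) *\<^sub>R \<gamma> t) * norm (g t)) \<le> c)"

lemma min_length_le:
  assumes "travel \<epsilon> 0 1 0 \<xi> c"
  shows "min_length \<rho> \<beta> \<epsilon> \<xi> \<le> c"
proof -
  obtain \<gamma> g S where *: "continuous_on {0..1} \<gamma>" "\<gamma> 0 = 0" "\<gamma> 1 = \<xi>" "finite S"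
    "\<And>t. t \<in> {0<..<1} - S \<Longrightarrow> (\<gamma> has_vector_derivative g t) (at t)" "g absolutely_integrable_on {0..1}"
    "integral {0..1} (\<lambda>t. weight ((1 / \<epsilon>) *\<^sub>R \<gamma> t) * norm (g t)) \<le> c"
    using assms unfolding travel_def by blast
  have weak: "weak_derivative \<gamma> g"
    by (rule weak_derivative_piecewise[OF *(1,4,5,6)])
  have "\<gamma> absolutely_integrable_on {0..1}"
    using *(1) by (rule absolutely_integrable_continuous_real)
  then have \<gamma>: "\<gamma> \<in> W11_joining 0 \<xi>"
    using weak * by (auto simp: W11_joining_def W11_def absolutely_integrable_on_Icc_iff_Ioo)
  have "min_length \<rho> \<beta> \<epsilon> \<xi> \<le> weighted_length \<rho> \<beta> \<epsilon> \<gamma> g"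
    unfolding min_length_def
  proof (rule cInf_lower)
    show "bdd_below {weighted_length \<rho> \<beta> \<epsilon> \<gamma> g |\<gamma> g. \<gamma> \<in> W11_joining 0 \<xi> \<and> weak_derivative \<gamma> g}"
      by (rule bdd_belowI[of _ "norm \<xi>"]) (auto intro: norm_le_weighted_length)
  qed (use \<gamma> weak in blast)
  also have "\<dots> \<le> c"
    using *(7) weighted_length_increments(2)[OF *(1) weak, of \<epsilon>] by simp
  finally show ?thesis .
qed

lemma travel_segment:
  fixes p q :: "real \<times> real"
  assumes ab: "a < b" and k: "\<And>u. u \<in> {0..1} \<Longrightarrow> weight ((1 / \<epsilon>) *\<^sub>R (p + u *\<^sub>R (q - p))) \<le> k"
  shows "travel \<epsilon> a b p q (k * norm (q - p))"
proof -
  define \<gamma> where "\<gamma> = (\<lambda>t. p + ((t - a) / (b - a)) *\<^sub>R (q - p))"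
  define v where "v = (1 / (b - a)) *\<^sub>R (q - p)"
  have cont: "continuous_on {a..b} \<gamma>" unfolding \<gamma>_def using ab by (intro continuous_intros) auto
  have deriv: "(\<gamma> has_vector_derivative v) (at t)" for t
    unfolding \<gamma>_def v_def using ab by (auto intro!: derivative_eq_intros simp: has_vector_derivative_def)
  have v_int: "(\<lambda>t. v) absolutely_integrable_on {a..b}"
    by (rule absolutely_integrable_continuous_real) simp
  have "(\<lambda>t. weight ((1 / \<epsilon>) *\<^sub>R \<gamma> t) * norm v) absolutely_integrable_on {a..b}"
    by (rule set_integrable_weight[OF _ _ v_int]) (auto intro!: continuous_intros cont)
  then have int: "(\<lambda>t. weight ((1 / \<epsilon>) *\<^sub>R \<gamma> t) * norm v) integrable_on {a..b}"
    by (simp add: absolutely_integrable_on_def)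
  have "integral {a..b} (\<lambda>t. weight ((1 / \<epsilon>) *\<^sub>R \<gamma> t) * norm v) \<le> integral {a..b} (\<lambda>t. k * norm v)"
  proof (rule integral_le[OF int])
    fix t assume "t \<in> {a..b}"
    then have "(t - a) / (b - a) \<in> {0..1}" using ab by simp
    from k[OF this] show "weight ((1 / \<epsilon>) *\<^sub>R \<gamma> t) * norm v \<le> k * norm v"
      unfolding \<gamma>_def by (rule mult_right_mono) simp
  qed (rule integrable_const_ivl)
  also have "\<dots> = k * norm (q - p)" using ab by (simp add: v_def)
  finally have le: "integral {a..b} (\<lambda>t. weight ((1 / \<epsilon>) *\<^sub>R \<gamma> t) * norm v) \<le> k * norm (q - p)" .
  show ?thesis
    unfolding travel_def
  proof (rule exI[of _ \<gamma>], rule exI[of _ "\<lambda>t. v"], rule exI[of _ "{}"], intro conjI ballI)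
    show "\<gamma> a = p" "\<gamma> b = q" using ab by (simp_all add: \<gamma>_def)
  qed (use cont deriv v_int int le in auto)
qed

lemma travel_trans:
  assumes ab: "a < m" "m < b" and 1: "travel \<epsilon> a m p q c" and 2: "travel \<epsilon> m b q r d"
  shows "travel \<epsilon> a b p r (c + d)"
proof -
  obtain \<gamma>1 g1 S1 where 1: "continuous_on {a..m} \<gamma>1" "\<gamma>1 a = p" "\<gamma>1 m = q" "finite S1"
    "\<And>t. t \<in> {a<..<m} - S1 \<Longrightarrow> (\<gamma>1 has_vector_derivative g1 t) (at t)" "g1 absolutely_integrable_on {a..m}"
    "(\<lambda>t. weight ((1 / \<epsilon>) *\<^sub>R \<gamma>1 t) * norm (g1 t)) integrable_on {a..m}"
    "integral {a..m} (\<lambda>t. weight ((1 / \<epsilon>) *\<^sub>R \<gamma>1 t) * norm (g1 t)) \<le> c"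
    using 1 unfolding travel_def by blast
  obtain \<gamma>2 g2 S2 where 2: "continuous_on {m..b} \<gamma>2" "\<gamma>2 m = q" "\<gamma>2 b = r" "finite S2"
    "\<And>t. t \<in> {m<..<b} - S2 \<Longrightarrow> (\<gamma>2 has_vector_derivative g2 t) (at t)" "g2 absolutely_integrable_on {m..b}"
    "(\<lambda>t. weight ((1 / \<epsilon>) *\<^sub>R \<gamma>2 t) * norm (g2 t)) integrable_on {m..b}"
    "integral {m..b} (\<lambda>t. weight ((1 / \<epsilon>) *\<^sub>R \<gamma>2 t) * norm (g2 t)) \<le> d"
    using 2 unfolding travel_def by blast
  define \<gamma> where "\<gamma> = (\<lambda>t. if t \<le> m then \<gamma>1 t else \<gamma>2 t)"
  define g where "g = (\<lambda>t. if t \<le> m then g1 t else g2 t)"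
  have cont: "continuous_on {a..b} \<gamma>"
    unfolding \<gamma>_def
    by (rule continuous_on_cases_le) (use 1(1,3) 2(1,2) ab in \<open>auto intro!: continuous_intros elim!: continuous_on_subset\<close>)
  have deriv: "(\<gamma> has_vector_derivative g t) (at t)" if t: "t \<in> {a<..<b} - (S1 \<union> S2 \<union> {m})" for t
  proof (cases "t < m")
    case True
    have "(\<gamma>1 has_vector_derivative g1 t) (at t)" using 1(5) t True by auto
    then have "(\<gamma> has_vector_derivative g1 t) (at t)"
      by (rule has_vector_derivative_transform_within_open[of _ _ _ "{..<m}"]) (use True in \<open>auto simp: \<gamma>_def\<close>)
    with True show ?thesis by (simp add: g_def)
  next
    case False
    then have False: "m < t" using t by auto
    have "(\<gamma>2 has_vector_derivative g2 t) (at t)" using 2(5) t False by auto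
    then have "(\<gamma> has_vector_derivative g2 t) (at t)"
      by (rule has_vector_derivative_transform_within_open[of _ _ _ "{m<..}"]) (use False in \<open>auto simp: \<gamma>_def\<close>)
    with False show ?thesis by (simp add: g_def)
  qed
  have combine: "((\<lambda>t. if t \<le> m then F1 t else F2 t) has_integral integral {a..m} F1 + integral {m..b} F2) {a..b}"
    if "F1 integrable_on {a..m}" "F2 integrable_on {m..b}" for F1 F2 :: "real \<Rightarrow> 'b::banach"
  proof (rule has_integral_combine[of a m b])
    show "((\<lambda>t. if t \<le> m then F1 t else F2 t) has_integral integral {a..m} F1) {a..m}"
      using integrable_integral[OF that(1)] by (rule has_integral_eq[rotated]) simp
    show "((\<lambda>t. if t \<le> m then F1 t else F2 t) has_integral integral {m..b} F2) {m..b}"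
      using integrable_integral[OF that(2)]
      by (rule has_integral_spike_finite[rotated 2, of _ _ _ "{m}"]) auto
  qed (use ab in auto)
  have if_eq: "(\<lambda>t. norm (g t)) = (\<lambda>t. if t \<le> m then norm (g1 t) else norm (g2 t))"
    "(\<lambda>t. weight ((1 / \<epsilon>) *\<^sub>R \<gamma> t) * norm (g t)) =
      (\<lambda>t. if t \<le> m then weight ((1 / \<epsilon>) *\<^sub>R \<gamma>1 t) * norm (g1 t) else weight ((1 / \<epsilon>) *\<^sub>R \<gamma>2 t) * norm (g2 t))"
    by (auto simp: g_def \<gamma>_def)
  have "g integrable_on {a..b}"
    unfolding g_def by (rule has_integral_integrable[OF combine]) (use 1(6) 2(6) in \<open>auto simp: absolutely_integrable_on_def\<close>)
  moreover have "(\<lambda>t. norm (g t)) integrable_on {a..b}"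
    unfolding if_eq by (rule has_integral_integrable[OF combine]) (use 1(6) 2(6) in \<open>auto simp: absolutely_integrable_on_def\<close>)
  ultimately have g: "g absolutely_integrable_on {a..b}" by (simp add: absolutely_integrable_on_def)
  note H = combine[OF 1(7) 2(7), folded if_eq(2)]
  show ?thesis
    unfolding travel_def
  proof (rule exI[of _ \<gamma>], rule exI[of _ g], rule exI[of _ "S1 \<union> S2 \<union> {m}"], intro conjI ballI)
    show "\<gamma> a = p" "\<gamma> b = r" using 1(2) 2(3) ab by (auto simp: \<gamma>_def)
    show "finite (S1 \<union> S2 \<union> {m})" using 1(4) 2(4) by simp
    show "(\<lambda>t. weight ((1 / \<epsilon>) *\<^sub>R \<gamma> t) * norm (g t)) integrable_on {a..b}"
      using H by (rule has_integral_integrable)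
    show "integral {a..b} (\<lambda>t. weight ((1 / \<epsilon>) *\<^sub>R \<gamma> t) * norm (g t)) \<le> c + d"
      using integral_unique[OF H] 1(8) 2(8) by simp
  qed (use cont deriv g in auto)
qed

text \<open>In units of the period: from the point \<open>p\<close> to \<open>q\<close> at cost \<open>c\<close>. Quantifying over all time
  intervals spares any reparametrization of curves.\<close>

definition reach :: "real \<Rightarrow> real \<times> real \<Rightarrow> real \<times> real \<Rightarrow> real \<Rightarrow> bool" where
  "reach \<epsilon> p q c \<longleftrightarrow> (\<forall>a b. a < b \<longrightarrow> travel \<epsilon> a b (\<epsilon> *\<^sub>R p) (\<epsilon> *\<^sub>R q) (\<epsilon> * c))"

lemma reach_trans:
  assumes "reach \<epsilon> p q c" "reach \<epsilon> q r d"
  shows "reach \<epsilon> p r (c + d)"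
  unfolding reach_def
proof (intro allI impI)
  fix a b :: real assume "a < b"
  then have "a < (a + b) / 2" "(a + b) / 2 < b" by simp_all
  with assms show "travel \<epsilon> a b (\<epsilon> *\<^sub>R p) (\<epsilon> *\<^sub>R r) (\<epsilon> * (c + d))"
    unfolding reach_def distrib_left by (blast intro: travel_trans)
qed

section \<open>Segments and the polygon through obstacle corners\<close>

lemma reach_segment_weight:
  assumes \<epsilon>: "0 < \<epsilon>" and k: "\<And>u. u \<in> {0..1} \<Longrightarrow> weight (p + u *\<^sub>R (q - p)) \<le> k"
  shows "reach \<epsilon> p q (k * dist p q)"
  unfolding reach_def
proof (intro allI impI)
  fix a b :: real assume "a < b"
  have eq: "(1 / \<epsilon>) *\<^sub>R (\<epsilon> *\<^sub>R p + u *\<^sub>R (\<epsilon> *\<^sub>R q - \<epsilon> *\<^sub>R p)) = p + u *\<^sub>R (q - p)" for u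
    using \<epsilon> by (simp add: scaleR_add_right scaleR_diff_right)
  have "travel \<epsilon> a b (\<epsilon> *\<^sub>R p) (\<epsilon> *\<^sub>R q) (k * norm (\<epsilon> *\<^sub>R q - \<epsilon> *\<^sub>R p))"
    by (rule travel_segment[OF \<open>a < b\<close>]) (simp only: eq k)
  moreover have "k * norm (\<epsilon> *\<^sub>R q - \<epsilon> *\<^sub>R p) = \<epsilon> * (k * dist p q)"
    using \<epsilon> by (simp add: scaleR_diff_right[symmetric] dist_norm norm_minus_commute)
  ultimately show "travel \<epsilon> a b (\<epsilon> *\<^sub>R p) (\<epsilon> *\<^sub>R q) (\<epsilon> * (k * dist p q))" by simp
qed

lemma reach_segment: "0 < \<epsilon> \<Longrightarrow> reach \<epsilon> p q (\<beta> * dist p q)"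
  by (rule reach_segment_weight) (simp_all add: weight_bounds)

lemma near_convex:
  assumes "near x i" "near y i" "u \<in> {0..1}"
  shows "near (x + u * (y - x)) i"
proof -
  have "x + u * (y - x) - of_int i = (1 - u) * (x - of_int i) + u * (y - of_int i)"
    by (simp add: algebra_simps)
  also have "\<bar>\<dots>\<bar> \<le> \<bar>(1 - u) * (x - of_int i)\<bar> + \<bar>u * (y - of_int i)\<bar>"
    by (rule abs_triangle_ineq)
  also have "\<dots> = (1 - u) * \<bar>x - of_int i\<bar> + u * \<bar>y - of_int i\<bar>"
    using assms(3) by (simp add: abs_mult)
  also have "\<dots> \<le> (1 - u) * ((1 - \<rho>) / 2) + u * ((1 - \<rho>) / 2)"
    using assms unfolding near_def by (intro add_mono mult_left_mono) simp_all
  also have "\<dots> = (1 - \<rho>) / 2" unfolding distrib_right[symmetric] by simp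
  finally show ?thesis by (simp add: near_def)
qed

lemma reach_share:
  assumes "0 < \<epsilon>" "share p q"
  shows "reach \<epsilon> p q (dist p q)"
proof -
  have "free (p + u *\<^sub>R (q - p))" if "u \<in> {0..1}" for u
    using assms(2) near_convex[OF _ _ that] unfolding share_def free_def
    by (simp add: fst_add snd_add fst_diff snd_diff) blast
  then show ?thesis
    using reach_segment_weight[OF assms(1), of p q 1] by (simp add: weight_eq)
qed

text \<open>The lower right corner of the crossing of corridors i and j, and thus the upper left
  corner of \<open>obstacle i (j - 1)\<close>.\<close>

definition corner :: "int \<Rightarrow> int \<Rightarrow> real \<times> real" where
  "corner i j = (of_int i + (1 - \<rho>) / 2, of_int j - (1 - \<rho>) / 2)"

text \<open>The path turns at \<open>q\<close>, the upper left corner of the crossing (i + k, j).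
  Its displacements (k - (1 - \<rho>), 1 - \<rho>) and (1 - \<rho>, 1 - (1 - \<rho>)) have the
  lengths \<open>ell \<rho> k\<close> and \<open>ell \<rho> 1\<close>, and each segment stays in one
  corridor.\<close>

lemma reach_block:
  assumes "0 < \<epsilon>"
  shows "reach \<epsilon> (corner i j) (corner (i + k) (j + 1)) (ell \<rho> (of_int k) + ell \<rho> 1)"
proof -
  define q where "q = (of_int (i + k) - (1 - \<rho>) / 2, of_int j + (1 - \<rho>) / 2)"
  have "near (snd (corner i j)) j" "near (snd q) j" "near (fst q) (i + k)" "near (fst (corner (i + k) (j + 1))) (i + k)"
    using rho_lt by (simp_all add: near_def corner_def q_def)
  then have "share (corner i j) q" "share q (corner (i + k) (j + 1))"
    unfolding share_def by blast+
  moreover have "dist (corner i j) q = ell \<rho> (of_int k)" "dist q (corner (i + k) (j + 1)) = ell \<rho> 1"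
    unfolding dist_norm ell_eq_norm corner_def q_def norm_Pair diff_Pair
    by (simp_all add: power2_commute add.commute field_simps) (simp_all add: power2_eq_square algebra_simps)
  ultimately show ?thesis using reach_trans reach_share[OF assms] by metis
qed

lemma reach_blocks:
  assumes "0 < \<epsilon>"
  shows "reach \<epsilon> (corner i j) (corner (i + int m * k) (j + int m)) (real m * (ell \<rho> (of_int k) + ell \<rho> 1))"
proof (induction m)
  case 0
  show ?case using reach_segment[OF assms, of "corner i j" "corner i j"] by simp
next
  case (Suc m)
  from reach_trans[OF Suc reach_block[OF assms, of _ _ k]] show ?case by (simp add: algebra_simps)
qed

lemma min_length_le_reach:
  assumes "0 < \<epsilon>" "reach \<epsilon> 0 ((1 / \<epsilon>) *\<^sub>R \<xi>) c"
  shows "min_length \<rho> \<beta> \<epsilon> \<xi> \<le> \<epsilon> * c"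
  using assms by (intro min_length_le) (force simp: reach_def)

text \<open>Here a and b are coordinates with respect to (n, 1) and (n + 1, 1), and the competitor
  makes as many whole blocks of each kind as fit. Straight segments at full weight
  \<open>\<beta>\<close> join it to the two endpoints. In units of the period they are at most 1 and
  2 n + 5 long, hence the error term.\<close>

lemma min_length_cone_le:
  assumes \<epsilon>: "0 < \<epsilon>" and ab: "0 \<le> a" "0 \<le> b" and n: "1 \<le> n"
  shows "min_length \<rho> \<beta> \<epsilon> (a * of_int n + b * (of_int n + 1), a + b)
    \<le> a * (ell \<rho> (of_int n) + ell \<rho> 1) + b * (ell \<rho> (of_int n + 1) + ell \<rho> 1) + \<beta> * (2 * of_int n + 6) * \<epsilon>"
proof -
  define \<xi> where "\<xi> = (a * of_int n + b * (of_int n + 1), a + b)"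
  define k l where "k = nat \<lfloor>a / \<epsilon>\<rfloor>" and "l = nat \<lfloor>b / \<epsilon>\<rfloor>"
  have kl: "real k \<le> a / \<epsilon>" "a / \<epsilon> < real k + 1" "real l \<le> b / \<epsilon>" "b / \<epsilon> < real l + 1"
    using ab \<epsilon> unfolding k_def l_def by (simp_all add: of_nat_nat)
  define c1 c2 where "c1 = ell \<rho> (of_int n) + ell \<rho> 1" and "c2 = ell \<rho> (of_int n + 1) + ell \<rho> 1"
  define p where "p = corner (int k * n + int l * (n + 1)) (int k + int l)"
  have "reach \<epsilon> (corner 0 0) p (real k * c1 + real l * c2)"
    using reach_trans[OF reach_blocks[OF \<epsilon>, of 0 0 k n] reach_blocks[OF \<epsilon>, of "0 + int k * n" "0 + int k" l "n + 1"]]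
    by (simp add: p_def c1_def c2_def)
  from reach_trans[OF reach_trans[OF reach_segment[OF \<epsilon>] this] reach_segment[OF \<epsilon>]]
  have "reach \<epsilon> 0 ((1 / \<epsilon>) *\<^sub>R \<xi>) (\<beta> * dist 0 (corner 0 0) + (real k * c1 + real l * c2) + \<beta> * dist p ((1 / \<epsilon>) *\<^sub>R \<xi>))" .
  from min_length_le_reach[OF \<epsilon> this]
  have "min_length \<rho> \<beta> \<epsilon> \<xi> \<le> \<epsilon> * (\<beta> * dist 0 (corner 0 0) + (real k * c1 + real l * c2) + \<beta> * dist p ((1 / \<epsilon>) *\<^sub>R \<xi>))" .
  also have "\<dots> \<le> \<epsilon> * (\<beta> * 1 + (a / \<epsilon> * c1 + b / \<epsilon> * c2) + \<beta> * (2 * of_int n + 5))"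
  proof (intro mult_left_mono add_mono mult_right_mono)
    have "dist 0 (corner 0 0) \<le> \<bar>(1 - \<rho>) / 2\<bar> + \<bar>(1 - \<rho>) / 2\<bar>"
      unfolding corner_def using norm_Pair_le[of "(1 - \<rho>) / 2" "- ((1 - \<rho>) / 2)"] by simp
    then show "dist 0 (corner 0 0) \<le> 1" using rho_gt rho_lt by simp
    define u v where "u = a / \<epsilon> - real k" and "v = b / \<epsilon> - real l"
    have uv: "0 \<le> u" "u \<le> 1" "0 \<le> v" "v \<le> 1" using kl by (auto simp: u_def v_def)
    have diff: "(1 / \<epsilon>) *\<^sub>R \<xi> - p = (u * of_int n + v * (of_int n + 1) - (1 - \<rho>) / 2, u + v + (1 - \<rho>) / 2)"
      by (simp add: \<xi>_def p_def corner_def u_def v_def algebra_simps add_divide_distrib)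
    have n': "1 \<le> (of_int n :: real)" using n by simp
    define s t where "s = u * of_int n" and "t = v * (of_int n + 1)"
    have "0 \<le> s" "s \<le> 1 * of_int n" "0 \<le> t" "t \<le> 1 * (of_int n + 1)"
      unfolding s_def t_def using uv n' by (auto intro!: mult_right_mono)
    then have "\<bar>s + t - (1 - \<rho>) / 2\<bar> \<le> 2 * of_int n + 2"
      using n' rho_gt rho_lt by (simp add: abs_le_iff field_simps)
    then have "\<bar>u * of_int n + v * (of_int n + 1) - (1 - \<rho>) / 2\<bar> \<le> 2 * of_int n + 2"
      by (simp only: s_def t_def)
    moreover have "\<bar>u + v + (1 - \<rho>) / 2\<bar> \<le> 3" using uv rho_gt rho_lt by (simp add: field_simps)
    ultimately have "norm ((1 / \<epsilon>) *\<^sub>R \<xi> - p) \<le> 2 * of_int n + 5"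
      unfolding diff using norm_Pair_le[of "u * of_int n + v * (of_int n + 1) - (1 - \<rho>) / 2" "u + v + (1 - \<rho>) / 2"]
      by simp
    then show "dist p ((1 / \<epsilon>) *\<^sub>R \<xi>) \<le> 2 * of_int n + 5" by (simp add: dist_norm norm_minus_commute)
    show "0 \<le> c1" "0 \<le> c2"
      unfolding c1_def c2_def using ell_pos[of "of_int n"] ell_pos[of "of_int n + 1"] ell_pos[of 1] by auto
  qed (use kl \<epsilon> beta_gt in auto)
  also have "\<dots> = a * c1 + b * c2 + \<beta> * (2 * of_int n + 6) * \<epsilon>"
    using \<epsilon> by (simp add: field_simps)
  finally show ?thesis by (simp add: \<xi>_def c1_def c2_def)
qed

section \<open>Rate of convergence, symmetries and the limit\<close>

lemma joining_nonempty: "\<exists>\<gamma> g. \<gamma> \<in> W11_joining 0 \<xi> \<and> weak_derivative \<gamma> g"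
proof -
  have "weak_derivative (\<lambda>t. t *\<^sub>R \<xi>) (\<lambda>t. \<xi>)"
    by (rule weak_derivative_piecewise[of _ "{}"])
      (auto intro!: continuous_intros absolutely_integrable_continuous_real derivative_eq_intros)
  moreover have "(\<lambda>t::real. t *\<^sub>R \<xi>) absolutely_integrable_on {0..1}"
    by (intro absolutely_integrable_continuous_real continuous_intros)
  ultimately show ?thesis
    by (intro exI[of _ "\<lambda>t. t *\<^sub>R \<xi>"] exI[of _ "\<lambda>t. \<xi>"])
      (auto simp: W11_joining_def W11_def absolutely_integrable_on_Icc_iff_Ioo intro!: continuous_intros)
qed

lemma min_length_ge:
  assumes "\<And>\<gamma> g. \<gamma> \<in> W11_joining 0 \<xi> \<Longrightarrow> weak_derivative \<gamma> g \<Longrightarrow> c \<le> weighted_length \<rho> \<beta> \<epsilon> \<gamma> g"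
  shows "c \<le> min_length \<rho> \<beta> \<epsilon> \<xi>"
  unfolding min_length_def
  by (rule cInf_greatest) (use assms joining_nonempty in blast)+

lemma min_length_approx:
  assumes "0 \<le> y" "y \<le> x"
  shows "\<exists>C. \<forall>\<epsilon>>0. \<bar>min_length \<rho> \<beta> \<epsilon> (x, y) - L_fun \<rho> x y\<bar> \<le> C * \<epsilon>"
proof (cases "y = 0")
  case True
  have "min_length \<rho> \<beta> \<epsilon> (x, y) = x" if \<epsilon>: "0 < \<epsilon>" for \<epsilon>
  proof (rule antisym)
    \<comment> \<open>On the axis the straight path stays in the corridor through the origin and
      attains the Euclidean lower bound, so there is no error at all.\<close>
    have "share 0 (1 / \<epsilon> * x, 0)" using near_zero unfolding share_def by auto
    from reach_share[OF \<epsilon> this] have "reach \<epsilon> 0 ((1 / \<epsilon>) *\<^sub>R (x, y)) (x / \<epsilon>)"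
      using assms True \<epsilon> by (simp add: norm_Pair)
    from min_length_le_reach[OF \<epsilon> this] show "min_length \<rho> \<beta> \<epsilon> (x, y) \<le> x" using \<epsilon> by simp
    have "norm (x, y) \<le> min_length \<rho> \<beta> \<epsilon> (x, y)"
      by (rule min_length_ge) (rule norm_le_weighted_length)
    then show "x \<le> min_length \<rho> \<beta> \<epsilon> (x, y)" using assms True by (simp add: norm_Pair)
  qed
  then show ?thesis using True by (intro exI[of _ 0]) (simp add: L_fun_def)
next
  case False
  with assms have y: "0 < y" by simp
  define n where "n = \<lfloor>x / y\<rfloor>"
  have n: "1 \<le> n" using assms y by (simp add: n_def le_floor_iff)
  interpret street_cone \<rho> n by standard (rule n)
  \<comment> \<open>\<open>y - b\<close> and \<open>b\<close> are the coordinates of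
    \<open>(x, y)\<close> with respect to (n, 1) and (n + 1, 1); the choice of n as a floor makes
    both nonnegative.\<close>
  define b where "b = x - of_int n * y"
  have "of_int n \<le> x / y" "x / y < of_int n + 1" by (simp_all add: n_def)
  then have b: "0 \<le> b" "b \<le> y" using y by (simp_all add: b_def field_simps)
  have \<xi>: "((y - b) * of_int n + b * (of_int n + 1), (y - b) + b) = (x, y)"
    by (simp add: b_def algebra_simps)
  have L: "L_fun \<rho> x y = y * ell \<rho> 1 + b * ell \<rho> (of_int n + 1) + (y - b) * ell \<rho> (of_int n)"
    using y by (simp add: L_fun_def n_def[symmetric] b_def)
  have L1: "L_fun \<rho> x y = (y - b) * (ell \<rho> (of_int n) + ell \<rho> 1) + b * (ell \<rho> (of_int n + 1) + ell \<rho> 1)"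
    unfolding L by (simp add: algebra_simps)
  have L2: "L_fun \<rho> x y = slope_x * x + slope_y * y"
    unfolding L slope_y_def offset_def slope_x_def b_def by (simp add: algebra_simps)
  have upper: "min_length \<rho> \<beta> \<epsilon> (x, y) \<le> L_fun \<rho> x y + \<beta> * (2 * of_int n + 6) * \<epsilon>" if "0 < \<epsilon>" for \<epsilon>
    using min_length_cone_le[OF that, of "y - b" b n] b n unfolding \<xi> L1 by simp
  have lower: "L_fun \<rho> x y - 8 * \<epsilon> \<le> min_length \<rho> \<beta> \<epsilon> (x, y)" if "0 < \<epsilon>" for \<epsilon>
    unfolding L2 by (rule min_length_ge) (use weighted_length_ge[OF _ _ that n, of _ "(x, y)"] in simp)
  show ?thesis
  proof (intro exI[of _ "\<beta> * (2 * of_int n + 6) + 8"] allI impI)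
    fix \<epsilon> :: real assume \<epsilon>: "0 < \<epsilon>"
    have "0 \<le> \<beta> * (2 * of_int n + 6) * \<epsilon>" using beta_gt n \<epsilon> by simp
    with upper[OF \<epsilon>] lower[OF \<epsilon>] \<epsilon>
    show "\<bar>min_length \<rho> \<beta> \<epsilon> (x, y) - L_fun \<rho> x y\<bar> \<le> (\<beta> * (2 * of_int n + 6) + 8) * \<epsilon>"
      unfolding abs_le_iff distrib_right[of _ 8] by linarith
  qed
qed

lemma blocked_uminus: "blocked (- t) \<longleftrightarrow> blocked t"
proof -
  have "near t i \<longleftrightarrow> near (- t) (- i)" for t i
    by (simp add: near_def abs_minus_commute)
  then show ?thesis by (metis minus_minus not_blocked_iff)
qed

lemma min_length_abs:
  "min_length \<rho> \<beta> \<epsilon> (x, y) = min_length \<rho> \<beta> \<epsilon> (max \<bar>x\<bar> \<bar>y\<bar>, min \<bar>x\<bar> \<bar>y\<bar>)"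
proof -
  have swap: "min_length \<rho> \<beta> \<epsilon> (y, x) = min_length \<rho> \<beta> \<epsilon> (x, y)" for x y
    using min_length_isometry[of "\<lambda>z. (snd z, fst z)" \<rho> \<beta> \<epsilon> "(x, y)"]
    by (auto simp: norm_prod_def weight_eq free_iff add.commute bounded_linear_Pair bounded_linear_fst bounded_linear_snd)
  have flip1: "min_length \<rho> \<beta> \<epsilon> (- x, y) = min_length \<rho> \<beta> \<epsilon> (x, y)" for x y
    using min_length_isometry[of "\<lambda>z. (- fst z, snd z)" \<rho> \<beta> \<epsilon> "(x, y)"]
    by (auto simp: norm_prod_def weight_eq free_iff blocked_uminus bounded_linear_Pair bounded_linear_minus bounded_linear_fst bounded_linear_snd)
  have flip2: "min_length \<rho> \<beta> \<epsilon> (x, - y) = min_length \<rho> \<beta> \<epsilon> (x, y)" for x y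
    using swap flip1 by metis
  have "min_length \<rho> \<beta> \<epsilon> (x, y) = min_length \<rho> \<beta> \<epsilon> (\<bar>x\<bar>, \<bar>y\<bar>)"
    by (simp add: abs_if flip1 flip2)
  then show ?thesis using swap by (simp add: max_def min_def)
qed

end

theorem theorem3p1:
  fixes \<rho> \<beta> :: real
  assumes "1 / 2 < \<rho>" and "\<rho> < 1" and "\<beta> > 2"
  shows "\<forall>x y :: real.
    limit_metric \<rho> \<beta> (x, y) = L_fun \<rho> (max \<bar>x\<bar> \<bar>y\<bar>) (min \<bar>x\<bar> \<bar>y\<bar>)"
proof (intro allI)
  fix x y :: real
  interpret weighted_grid \<rho> \<beta> by standard (use assms in auto)
  let ?L = "L_fun \<rho> (max \<bar>x\<bar> \<bar>y\<bar>) (min \<bar>x\<bar> \<bar>y\<bar>)"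
  obtain C where C: "\<And>\<epsilon>. 0 < \<epsilon> \<Longrightarrow> \<bar>min_length \<rho> \<beta> \<epsilon> (x, y) - ?L\<bar> \<le> C * \<epsilon>"
    using min_length_approx[of "min \<bar>x\<bar> \<bar>y\<bar>" "max \<bar>x\<bar> \<bar>y\<bar>"] min_length_abs[of _ x y]
    by (auto simp: min_le_iff_disj)
  \<comment> \<open>The constant \<open>C\<close> depends on the point but not on \<epsilon>, so the
    estimate proves that the limit exists; only then does \<open>Lim\<close> have a known
    value.\<close>
  have "((\<lambda>\<epsilon>. min_length \<rho> \<beta> \<epsilon> (x, y) - ?L) \<longlongrightarrow> 0) (at_right 0)"
  proof (rule tendsto_rabs_zero_cancel, rule tendsto_sandwich[where f = "\<lambda>_. 0" and h = "\<lambda>\<epsilon>. C * \<epsilon>"])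
    show "\<forall>\<^sub>F \<epsilon> in at_right 0. \<bar>min_length \<rho> \<beta> \<epsilon> (x, y) - ?L\<bar> \<le> C * \<epsilon>"
      using C by (auto simp: eventually_at_filter)
    show "((\<lambda>\<epsilon>. C * \<epsilon>) \<longlongrightarrow> 0) (at_right 0)" by (auto intro!: tendsto_eq_intros)
  qed auto
  then have "((\<lambda>\<epsilon>. min_length \<rho> \<beta> \<epsilon> (x, y)) \<longlongrightarrow> ?L) (at_right 0)"
    by (simp add: LIM_zero_iff)
  then show "limit_metric \<rho> \<beta> (x, y) = ?L"
    unfolding limit_metric_def by (intro tendsto_Lim) auto
qed

end
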